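(* Let $K(x,y)=\varphi(x)\varphi(y)\sum_{k=0}^\infty\alpha_k^{-1}x^ky^k$ be a weighted power series kernel on $[-1,1]\times[-1,1]$ and $p\in\{2,\infty\}$ (with $1/p=0$ if $p=\infty$). Suppose that there are constants $\varphi_{\min},\varphi_{\max}$ with $0<\varphi_{\min}\le|\varphi(x)|\le\varphi_{\max}<\infty$ for all $x\in[-1,1]$, and a constant $\lambda>0$ such that $$\frac{\alpha_k}{\alpha_n}\le\lambda^{n-k}\frac{k!}{n!}\quad\text{for all } n\ge0,\ 0\le k\le n.$$ Set $$c_{1,\infty}=\sqrt{\frac{2}{1+\lambda}}\,e^{-\frac1{32}\lambda^2}\varphi_{\min},\qquad c_{1,2}=\frac{2\sqrt{2\pi}}{3e^3\sqrt{3(4+\lambda)}}\,e^{-\frac1{32}\lambda^2}\varphi_{\min},\qquad c_{2,\infty}=\sqrt{c_L(\lambda)},\qquad c_{2,2}=\sqrt{2c_L(\lambda)}.$$ If $x_1,\dots,x_n\in[-1,1]$ are distinct, then $$c_{1,p}\,2^{-n}\alpha_n^{-1/2}\le e_p^{\min}(x_1,\dots,x_n)\le c_{2,p}\,\varphi_{\max}\,n^{-1/8-1/p}e^{\sqrt{\lambda n}}\,2^n\alpha_n^{-1/2},$$ $$c_{1,p}\,2^{-n}\alpha_n^{-1/2}\le e_p^{\min}(n)\le 2c_{2,p}\,\varphi_{\max}\,n^{-1/8}e^{\sqrt{\lambda n}}\,2^{-n}\alpha_n^{-1/2},$$ and, for every $x\in[-1,1]\setminus\{x_1,\dots,x_n\}$,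 $$c_{1,\infty}\,2^{-2n}\alpha_n^{-1/2}\le\frac{e^{\min}(x\mid x_1,\dots,x_n)}{|\prod_{k=1}^n(x-x_k)|}\le c_{2,\infty}\,\varphi_{\max}\,n^{-1/8}e^{\sqrt{\lambda n}}\alpha_n^{-1/2},$$ where all lower bounds hold when $n\ge1$ and all upper bounds hold when $n\ge m_L(\lambda)$.
   Context: Here $\varphi:[-1,1]\to\mathbb R$ is a non-vanishing Lebesgue measurable function and $(\alpha_k)_{k\ge0}$ is a positive sequence with $\sum_{k}\alpha_k^{-1}<\infty$. $H(K)$ is the reproducing kernel Hilbert space of $K$; explicitly $$H(K)=\Big\{f(x)=\varphi(x)\sum_{k=0}^\infty c_kx^k\ :\ \|f\|_K^2=\sum_{k=0}^\infty\alpha_kc_k^2<\infty\Big\}.$$ $L^p=L^p([-1,1])$ with norm $\|\cdot\|_p$. The worst-case errors are $$e_p^{\min}(x_1,\dots,x_n)=\inf_{\psi_1,\dots,\psi_n\in L^p}\ \sup_{0\ne f\in H(K)}\frac{\|f-\sum_{k=1}^n f(x_k)\psi_k\|_p}{\|f\|_K},\qquad e_p^{\min}(n)=\inf_{x_1,\dots,x_n\in[-1,1]}e_p^{\min}(x_1,\dots,x_n),$$ $$e^{\min}(x\mid x_1,\dots,x_n)=\inf_{u_1,\dots,u_n\in\mathbb R}\ \sup_{0\ne f\in H(K)}\frac{|f(x)-\sum_{k=1}^n f(x_k)u_k|}{\|f\|_K}.$$ For $\lambda>0$, $$c_L(\lambda)=\frac{e^{\frac12\lambda+2\sqrt\lambda}}{2\sqrt\pi\,\lambda^{1/4}}\Big(3+\sqrt{\tfrac{\pi}{e}}+\frac{2}{\sqrt\pi\,\lambda^{1/4}}+\frac{7}{16\sqrt\lambda}+\sqrt\lambda\,(2+\lambda)\Big),\qquad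 m_L(\lambda)=\max\Big\{5\lambda,\ \lambda\Big(1+\frac\lambda2\Big)^2,\ \frac9\lambda\Big\}.$$ *)

theory Defs
  imports "HOL-Probability.Essential_Supremum" "HOL-Analysis.Analysis"
begin

section \<open>Power series kernels and their reproducing kernel Hilbert spaces\<close>

definition wps_kernel :: "(real \<Rightarrow> real) \<Rightarrow> (nat \<Rightarrow> real) \<Rightarrow> real \<Rightarrow> real \<Rightarrow> real" where
  "wps_kernel \<phi> \<alpha> x y = \<phi> x * \<phi> y * (\<Sum>k. inverse (\<alpha> k) * x ^ k * y ^ k)"

text \<open>Functions on \<open>[-1,1]\<close> are represented by total functions on the reals of which only
  the restriction to \<open>[-1,1]\<close> matters.\<close>

definition HK_expansion :: "(real \<Rightarrow> real) \<Rightarrow> (nat \<Rightarrow> real) \<Rightarrow> (real \<Rightarrow> real) \<Rightarrow> (nat \<Rightarrow> real) \<Rightarrow> bool" where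
  "HK_expansion \<phi> \<alpha> f c \<longleftrightarrow>
     summable (\<lambda>k. \<alpha> k * (c k)\<^sup>2) \<and> (\<forall>x\<in>{-1..1}. f x = \<phi> x * (\<Sum>k. c k * x ^ k))"

definition HK :: "(real \<Rightarrow> real) \<Rightarrow> (nat \<Rightarrow> real) \<Rightarrow> (real \<Rightarrow> real) set" where
  "HK \<phi> \<alpha> = {f. \<exists>c. HK_expansion \<phi> \<alpha> f c}"

definition HK_norm :: "(real \<Rightarrow> real) \<Rightarrow> (nat \<Rightarrow> real) \<Rightarrow> (real \<Rightarrow> real) \<Rightarrow> real" where
  "HK_norm \<phi> \<alpha> f = sqrt (\<Sum>k. \<alpha> k * ((THE c. HK_expansion \<phi> \<alpha> f c) k)\<^sup>2)"

definition HK_nonzero :: "(real \<Rightarrow> real) \<Rightarrow> (nat \<Rightarrow> real) \<Rightarrow> (real \<Rightarrow> real) set" where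
  "HK_nonzero \<phi> \<alpha> = {f \<in> HK \<phi> \<alpha>. \<exists>x\<in>{-1..1}. f x \<noteq> 0}"

lemma HK_expansion_summable:
  assumes "\<And>k. \<alpha> k > 0" and "summable (\<lambda>k. inverse (\<alpha> k))"
    and "HK_expansion \<phi> \<alpha> f c" and "x \<in> {-1..1}"
  shows "summable (\<lambda>k. c k * x ^ k)"
proof (rule summable_comparison_test')
  show "summable (\<lambda>k. inverse (\<alpha> k) + \<alpha> k * (c k)\<^sup>2)"
    using assms(2,3) by (intro summable_add) (auto simp: HK_expansion_def)
  fix k :: nat assume "k \<ge> 0"
  have "0 \<le> inverse (\<alpha> k) * (1 - \<alpha> k * \<bar>c k\<bar>)\<^sup>2"
    using assms(1)[of k] by simp
  also have "\<dots> = inverse (\<alpha> k) - 2 * \<bar>c k\<bar> + \<alpha> k * (c k)\<^sup>2"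
    using assms(1)[of k] by (simp add: field_simps power2_eq_square)
  finally have "\<bar>c k\<bar> \<le> inverse (\<alpha> k) + \<alpha> k * (c k)\<^sup>2" by linarith
  moreover have "\<bar>c k * x ^ k\<bar> \<le> \<bar>c k\<bar>"
    using assms(4) by (auto simp: abs_mult power_abs intro!: mult_left_le power_le_one)
  ultimately show "norm (c k * x ^ k) \<le> inverse (\<alpha> k) + \<alpha> k * (c k)\<^sup>2"
    by simp
qed

lemma HK_expansion_unique:
  assumes "\<And>k. \<alpha> k > 0" and "summable (\<lambda>k. inverse (\<alpha> k))"
    and "\<And>x. x \<in> {-1..1} \<Longrightarrow> \<phi> x \<noteq> 0"
    and "HK_expansion \<phi> \<alpha> f c" and "HK_expansion \<phi> \<alpha> f d"
  shows "c = d"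
proof -
  have *: "(\<lambda>k. (c k - d k) * x ^ k) sums 0" if "norm x < 1" for x :: real
  proof -
    have x: "x \<in> {-1..1}" using that by auto
    have "(\<Sum>k. c k * x ^ k) = (\<Sum>k. d k * x ^ k)"
      using assms(3)[OF x] assms(4,5) x by (auto simp: HK_expansion_def)
    then have "(\<lambda>k. c k * x ^ k - d k * x ^ k) sums 0"
      using sums_diff[OF summable_sums summable_sums,
          OF HK_expansion_summable[OF assms(1,2,4) x] HK_expansion_summable[OF assms(1,2,5) x]]
      by simp
    then show ?thesis by (simp add: left_diff_distrib)
  qed
  have "c k - d k = 0" for k
  proof (rule ccontr)
    assume ne: "c k - d k \<noteq> 0"
    define m where "m = (LEAST k. c k - d k \<noteq> 0)"
    have m: "c m - d m \<noteq> 0" unfolding m_def by (rule LeastI[of _ k]) (rule ne)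
    have lt: "c i - d i = 0" if "i < m" for i
      using not_less_Least that unfolding m_def by blast
    let ?b = "\<lambda>n. c (n + m) - d (n + m)"
    have **: "(\<lambda>n. ?b n * x ^ n) sums 0" if "norm x < 1" "x \<noteq> 0" for x :: real
    proof -
      have "(\<lambda>n. (c (n + m) - d (n + m)) * x ^ (n + m)) sums (0 - (\<Sum>i<m. (c i - d i) * x ^ i))"
        using sums_split_initial_segment[OF *[OF that(1)], of m] by simp
      then have "(\<lambda>n. ?b n * x ^ (n + m)) sums 0" using lt by simp
      then have "(\<lambda>n. (?b n * x ^ (n + m)) / x ^ m) sums (0 / x ^ m)" by (rule sums_divide)
      then show ?thesis using that(2) by (simp add: power_add)
    qed
    have "((\<lambda>x::real. 0) \<longlongrightarrow> ?b 0) (at 0)"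
      by (rule powser_limit_0_strong[where s = 1]) (use ** in auto)
    then have "?b 0 = 0" using tendsto_const_iff[of "at (0::real)"] by (metis trivial_limit_at)
    then show False using m by simp
  qed
  then show ?thesis by auto
qed

text \<open>The coefficient sequence of an element of \<open>H(K)\<close> is unique, hence the definite
  description in \<open>HK_norm\<close> is harmless.\<close>

lemma HK_norm_eq:
  assumes "\<And>k. \<alpha> k > 0" and "summable (\<lambda>k. inverse (\<alpha> k))"
    and "\<And>x. x \<in> {-1..1} \<Longrightarrow> \<phi> x \<noteq> 0" and "HK_expansion \<phi> \<alpha> f c"
  shows "HK_norm \<phi> \<alpha> f = sqrt (\<Sum>k. \<alpha> k * (c k)\<^sup>2)"
proof -
  have "(THE c. HK_expansion \<phi> \<alpha> f c) = c"
    using assms(4) HK_expansion_unique[OF assms(1-3) _ assms(4)] by blast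
  then show ?thesis by (simp add: HK_norm_def)
qed

text \<open>The kernel sections lie in \<open>H(K)\<close>, and the inner product
  \<open>\<Sum>k. \<alpha> k * c k * d k\<close> belonging to the norm reproduces point evaluations.\<close>

lemma wps_kernel_HK_expansion:
  assumes pos: "\<And>k. \<alpha> k > 0" and sm: "summable (\<lambda>k. inverse (\<alpha> k))" and y: "y \<in> {-1..1}"
  shows "HK_expansion \<phi> \<alpha> (\<lambda>x. wps_kernel \<phi> \<alpha> x y) (\<lambda>k. \<phi> y * inverse (\<alpha> k) * y ^ k)"
  unfolding HK_expansion_def
proof (intro conjI ballI)
  have "summable (\<lambda>k. (\<phi> y)\<^sup>2 * (inverse (\<alpha> k) * (y ^ k)\<^sup>2))"
  proof (intro summable_mult summable_comparison_test'[OF sm])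
    fix k :: nat
    have "(y ^ k)\<^sup>2 \<le> 1"
      using y by (auto simp: abs_square_le_1 power_abs intro!: power_le_one)
    then show "norm (inverse (\<alpha> k) * (y ^ k)\<^sup>2) \<le> inverse (\<alpha> k)"
      using pos[of k] by (auto simp: abs_mult intro!: mult_left_le)
  qed
  then show "summable (\<lambda>k. \<alpha> k * (\<phi> y * inverse (\<alpha> k) * y ^ k)\<^sup>2)"
    by (rule summable_cong[THEN iffD1, rotated])
      (use pos in \<open>auto simp: field_simps power2_eq_square less_imp_neq[symmetric]\<close>)
  fix x :: real assume x: "x \<in> {-1..1}"
  have "summable (\<lambda>k. inverse (\<alpha> k) * x ^ k * y ^ k)"
  proof (intro summable_comparison_test'[OF sm])
    fix k :: nat
    have "\<bar>x ^ k * y ^ k\<bar> \<le> 1"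
      using x y by (auto simp: abs_mult power_abs intro!: mult_le_one power_le_one)
    then show "norm (inverse (\<alpha> k) * x ^ k * y ^ k) \<le> inverse (\<alpha> k)"
      using pos[of k] by (auto simp: abs_mult mult.assoc intro!: mult_left_le)
  qed
  from suminf_mult[OF this, of "\<phi> y"]
  show "wps_kernel \<phi> \<alpha> x y = \<phi> x * (\<Sum>k. \<phi> y * inverse (\<alpha> k) * y ^ k * x ^ k)"
    by (simp add: wps_kernel_def mult_ac)
qed

lemma wps_kernel_reproducing:
  assumes pos: "\<And>k. \<alpha> k > 0" and sm: "summable (\<lambda>k. inverse (\<alpha> k))"
    and f: "HK_expansion \<phi> \<alpha> f c" and y: "y \<in> {-1..1}"
  shows "(\<Sum>k. \<alpha> k * c k * (\<phi> y * inverse (\<alpha> k) * y ^ k)) = f y"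
proof -
  have "(\<Sum>k. \<alpha> k * c k * (\<phi> y * inverse (\<alpha> k) * y ^ k)) = (\<Sum>k. \<phi> y * (c k * y ^ k))"
    by (rule suminf_cong) (use pos in \<open>simp add: field_simps less_imp_neq[symmetric]\<close>)
  also have "\<dots> = f y"
    using f y suminf_mult[OF HK_expansion_summable[OF pos sm f y], of "\<phi> y"]
    by (simp add: HK_expansion_def)
  finally show ?thesis .
qed

section \<open>Worst-case errors\<close>

text \<open>Errors live in \<open>[0,\<infinity>]\<close>, so that every infimum and supremum below is genuine.
  For \<open>p < \<infinity>\<close> the exponent is intended to be in \<open>[1,\<infinity>)\<close>.\<close>

definition Lp_norm :: "ennreal \<Rightarrow> (real \<Rightarrow> real) \<Rightarrow> ennreal" where
  "Lp_norm p g =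
    (if p = \<infinity> then esssup (lebesgue_on {-1..1}) (\<lambda>x. ennreal \<bar>g x\<bar>)
     else let I = (\<integral>\<^sup>+x. ennreal (\<bar>g x\<bar> powr enn2real p) \<partial>lebesgue_on {-1..1})
          in if I = \<infinity> then \<infinity> else ennreal (enn2real I powr (1 / enn2real p)))"

definition Lp :: "ennreal \<Rightarrow> (real \<Rightarrow> real) set" where
  "Lp p = {g \<in> borel_measurable (lebesgue_on {-1..1}). Lp_norm p g < \<infinity>}"

text \<open>Nodes and weights are indexed by \<open>{1..n}\<close>; other indices are irrelevant.\<close>

definition emin_points ::
    "(real \<Rightarrow> real) \<Rightarrow> (nat \<Rightarrow> real) \<Rightarrow> ennreal \<Rightarrow> nat \<Rightarrow> (nat \<Rightarrow> real) \<Rightarrow> ennreal" where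
  "emin_points \<phi> \<alpha> p n X =
    (INF \<psi>\<in>{\<psi> :: nat \<Rightarrow> real \<Rightarrow> real. \<forall>k\<in>{1..n}. \<psi> k \<in> Lp p}.
      SUP f\<in>HK_nonzero \<phi> \<alpha>.
        Lp_norm p (\<lambda>t. f t - (\<Sum>k=1..n. f (X k) * \<psi> k t)) / ennreal (HK_norm \<phi> \<alpha> f))"

definition emin :: "(real \<Rightarrow> real) \<Rightarrow> (nat \<Rightarrow> real) \<Rightarrow> ennreal \<Rightarrow> nat \<Rightarrow> ennreal" where
  "emin \<phi> \<alpha> p n = (INF X\<in>{X. \<forall>k\<in>{1..n}. X k \<in> {-1..1}}. emin_points \<phi> \<alpha> p n X)"

definition emin_at ::
    "(real \<Rightarrow> real) \<Rightarrow> (nat \<Rightarrow> real) \<Rightarrow> nat \<Rightarrow> (nat \<Rightarrow> real) \<Rightarrow> real \<Rightarrow> ennreal" where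
  "emin_at \<phi> \<alpha> n X x =
    (INF u\<in>(UNIV :: (nat \<Rightarrow> real) set).
      SUP f\<in>HK_nonzero \<phi> \<alpha>.
        ennreal \<bar>f x - (\<Sum>k=1..n. f (X k) * u k)\<bar> / ennreal (HK_norm \<phi> \<alpha> f))"

section \<open>Constants\<close>

definition c_L :: "real \<Rightarrow> real" where
  "c_L lam = exp (lam / 2 + 2 * sqrt lam) / (2 * sqrt pi * lam powr (1/4)) *
     (3 + sqrt (pi / exp 1) + 2 / (sqrt pi * lam powr (1/4)) + 7 / (16 * sqrt lam)
        + sqrt lam * (2 + lam))"

definition m_L :: "real \<Rightarrow> real" where
  "m_L lam = Max {5 * lam, lam * (1 + lam / 2)\<^sup>2, 9 / lam}"

definition c1_inf :: "real \<Rightarrow> real \<Rightarrow> real" where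
  "c1_inf lam \<phi>min = sqrt (2 / (1 + lam)) * exp (- (lam\<^sup>2 / 32)) * \<phi>min"

definition c1_two :: "real \<Rightarrow> real \<Rightarrow> real" where
  "c1_two lam \<phi>min =
     2 * sqrt (2 * pi) / (3 * exp 3 * sqrt (3 * (4 + lam))) * exp (- (lam\<^sup>2 / 32)) * \<phi>min"

definition c2_inf :: "real \<Rightarrow> real" where
  "c2_inf lam = sqrt (c_L lam)"

definition c2_two :: "real \<Rightarrow> real" where
  "c2_two lam = sqrt (2 * c_L lam)"

text \<open>Only \<open>p = 2\<close> and \<open>p = \<infinity>\<close> are meaningful here.\<close>

definition c1 :: "ennreal \<Rightarrow> real \<Rightarrow> real \<Rightarrow> real" where
  "c1 p lam \<phi>min = (if p = \<infinity> then c1_inf lam \<phi>min else c1_two lam \<phi>min)"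

definition c2 :: "ennreal \<Rightarrow> real \<Rightarrow> real" where
  "c2 p lam = (if p = \<infinity> then c2_inf lam else c2_two lam)"

end

theory Submission
  imports Defs
begin

text \<open>
  Upper bounds. If \<open>f = \<phi> * (\<Sum>k. c k * x ^ k)\<close> is interpolated by \<open>\<phi>\<close> times a polynomial of
  degree less than \<open>n\<close>, the error at \<open>t\<close> is \<open>\<phi> t * (\<Prod>i. t - X i) * (\<Sum>k. c k * h k t)\<close>, where
  \<open>h k t\<close> is the divided difference of the \<open>k\<close>-th monomial at the nodes and \<open>t\<close>. It is a complete
  homogeneous symmetric polynomial, a sum of \<open>k choose n\<close> products of numbers in \<open>[-1,1]\<close>. By
  Cauchy-Schwarz the square of the series is at most the squared norm of \<open>f\<close> times
  \<open>\<Sum>k. (k choose n)\<^sup>2 / \<alpha> k\<close>, and the growth condition bounds this by \<open>1 / \<alpha> n\<close> times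
  \<open>\<Sum>j. \<lambda> ^ j / j! * (n + j choose j) = e\<^sup>\<lambda> L\<^sub>n(-\<lambda>)\<close>, a Laguerre polynomial. With \<open>y = sqrt (\<lambda> n)\<close>
  and \<open>q = sqrt (\<lambda> / n)\<close> one has \<open>\<lambda> ^ j / j! = (y ^ j / j!) * q ^ j\<close>. Here
  \<open>max\<^sub>j y ^ j / j!\<close> is of the order of \<open>e\<^sup>y / sqrt y\<close>, which gives the power \<open>n powr (-1/4)\<close>,
  and the negative binomial series gives \<open>(1 - q) ^ -(n + 1)\<close>, about \<open>e\<^sup>y\<close> again
  (\<open>laguerre_sum_bound\<close>). The three upper bounds differ only in the size of the node polynomial:
  at most \<open>2 ^ n\<close> pointwise, \<open>2 ^ n / sqrt n\<close> in \<open>L\<^sup>2\<close>, and \<open>2 ^ (1 - n)\<close> for Chebyshev nodes.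

  Lower bounds. The function \<open>\<phi> t * (\<Prod>i. t - X i)\<close> vanishes at all nodes, so every choice of
  weights reproduces it as zero, and its norm quotient bounds the error from below. By the growth
  condition its squared norm in \<open>H(K)\<close> is at most \<open>\<alpha> n\<close> times
  \<open>\<Sum>k\<le>n. \<lambda> ^ (n - k) * (k! / n!) * c\<^sub>k\<^sup>2\<close>, with \<open>c\<^sub>k\<close> the coefficients of a polynomial of degree \<open>n\<close>.
  This weighted sum has to be bounded by about \<open>4 ^ n\<close> times the squared supremum or \<open>L\<^sup>2\<close> norm
  of the polynomial (\<open>weighted_coeff_le_sup_norm\<close>, \<open>weighted_coeff_le_L2_norm\<close>). In both cases
  the polynomial is expanded in Chebyshev polynomials, of the first kind for the supremum norm and
  of the second kind for the \<open>L\<^sup>2\<close> norm. After the substitution \<open>x = cos \<theta>\<close>, Parseval's identity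
  bounds the expansion coefficients. Cauchy-Schwarz passes from them to the \<open>c\<^sub>k\<close>, and the
  coefficients of the Chebyshev polynomials are explicit enough to sum up: they give the Bessel
  type series \<open>\<Sum>m. (\<lambda> / 4) ^ (2 * m) / m!\<^sup>2\<close>.
\<close>

section \<open>Interpolation of monomials\<close>

text \<open>With nodes \<open>X 1, \<dots>, X n\<close>, the value \<open>divdiff X n k t\<close> is the complete homogeneous symmetric
  polynomial of degree \<open>k - n\<close> in \<open>X 1, \<dots>, X n, t\<close> (zero for \<open>k < n\<close>), that is, the divided
  difference of the monomial of degree \<open>k\<close> at these \<open>n + 1\<close> points.\<close>

fun divdiff :: "(nat \<Rightarrow> real) \<Rightarrow> nat \<Rightarrow> nat \<Rightarrow> real \<Rightarrow> real" where
  "divdiff X 0 k t = t ^ k"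
| "divdiff X (Suc n) 0 t = 0"
| "divdiff X (Suc n) (Suc k) t = divdiff X n k t + X (Suc n) * divdiff X (Suc n) k t"

text \<open>The identity \<open>h(S, t) - h(S, x) = (t - x) * h(S, x, t)\<close> for divided differences. It and the
  next lemma depend on each other, through one node less at a time, so the instance of the latter
  is a premise here.\<close>

lemma divdiff_diff_aux:
  assumes "\<And>k s t. divdiff X n (Suc k) t - t * divdiff X n k t = divdiff X n (Suc k) s - s * divdiff X n k s"
  shows "divdiff X n k t - divdiff X n k (X (Suc n)) = (t - X (Suc n)) * divdiff X (Suc n) k t"
proof (induction k)
  case 0
  then show ?case by (cases n) auto
next
  case (Suc k)
  define a where "a = X (Suc n)"
  have "divdiff X n (Suc k) t - divdiff X n (Suc k) a = t * divdiff X n k t - a * divdiff X n k a"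
    using assms[of k t a] by simp
  also have "\<dots> = (t - a) * divdiff X n k t + a * (divdiff X n k t - divdiff X n k a)"
    by (simp add: algebra_simps)
  also have "\<dots> = (t - a) * divdiff X (Suc n) (Suc k) t"
    unfolding Suc[folded a_def] by (simp add: a_def[symmetric] algebra_simps)
  finally show ?case by (simp add: a_def)
qed

text \<open>A complete homogeneous polynomial in \<open>X 1, \<dots>, X n, t\<close> splits by the exponent of \<open>t\<close>: removing
  \<open>t\<close> times the polynomial of one degree less leaves the part in which \<open>t\<close> does not occur.\<close>

lemma divdiff_step_const:
  "divdiff X n (Suc k) t - t * divdiff X n k t = divdiff X n (Suc k) s - s * divdiff X n k s"
proof (induction n arbitrary: k s t)
  case 0
  then show ?case by simp
next
  case (Suc n)
  have "divdiff X (Suc n) (Suc k) t - t * divdiff X (Suc n) k t = divdiff X n k (X (Suc n))" for t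
    using divdiff_diff_aux[OF Suc, of k t] by (simp add: algebra_simps)
  then show ?case by metis
qed

lemma divdiff_diff: "divdiff X n k t - divdiff X n k (X (Suc n)) = (t - X (Suc n)) * divdiff X (Suc n) k t"
  by (rule divdiff_diff_aux[OF divdiff_step_const])

text \<open>The recursion for \<open>divdiff\<close> is Pascal's rule with factors of modulus at most 1, in accordance
  with the \<open>k choose n\<close> terms of a complete homogeneous polynomial of degree \<open>k - n\<close> in
  \<open>n + 1\<close> variables.\<close>

lemma abs_divdiff_le:
  assumes "\<And>i. i \<in> {1..n} \<Longrightarrow> \<bar>X i\<bar> \<le> 1" "\<bar>t\<bar> \<le> 1"
  shows "\<bar>divdiff X n k t\<bar> \<le> real (k choose n)"
  using assms
proof (induction X n k t rule: divdiff.induct)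
  case (1 X k t)
  then show ?case by (simp add: power_abs power_le_one)
next
  case (3 X n k t)
  have "\<bar>X (Suc n) * divdiff X (Suc n) k t\<bar> \<le> 1 * real (k choose Suc n)"
    unfolding abs_mult using 3 by (intro mult_mono) auto
  moreover have "\<bar>divdiff X n k t\<bar> \<le> real (k choose n)" using 3 by auto
  ultimately show ?case by (simp add: abs_triangle_ineq[THEN order_trans])
qed auto

text \<open>One set of weight functions serves all monomials; it consists of the Lagrange basis polynomials,
  built up node by node as in Newton interpolation. A new node \<open>a\<close> subtracts from the old error
  at \<open>t\<close> the multiple \<open>P t / P a\<close> of the old error at \<open>a\<close>, so that the new error is
  \<open>P t\<close> times a difference of two divided differences.\<close>

lemma ex_interpolation_weights:
  assumes "inj_on X {1..n}"
  shows "\<exists>u :: nat \<Rightarrow> real \<Rightarrow> real. (\<forall>i. continuous_on UNIV (u i)) \<and>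
    (\<forall>k t. t ^ k - (\<Sum>i=1..n. X i ^ k * u i t) = divdiff X n k t * (\<Prod>i=1..n. t - X i))"
  using assms
proof (induction n)
  case 0
  show ?case by (rule exI[of _ "\<lambda>_ _. 0"]) auto
next
  case (Suc n)
  have inj: "inj_on X {1..n}" using Suc.prems by (rule inj_on_subset) auto
  obtain u :: "nat \<Rightarrow> real \<Rightarrow> real" where cont: "\<And>i. continuous_on UNIV (u i)"
    and u: "\<And>k t. t ^ k - (\<Sum>i=1..n. X i ^ k * u i t) = divdiff X n k t * (\<Prod>i=1..n. t - X i)"
    using Suc.IH[OF inj] by blast
  define a where "a = X (Suc n)"
  define P where "P t = (\<Prod>i=1..n. t - X i)" for t
  have Pa: "P a \<noteq> 0"
    using Suc.prems unfolding P_def a_def inj_on_def by force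
  have contP: "continuous_on UNIV P" unfolding P_def by (intro continuous_intros)
  \<comment> \<open>The Newton update; the new node takes the normalised node polynomial of the old ones as its weight.\<close>
  define v where "v i t = (if i = Suc n then P t / P a else u i t - P t / P a * u i a)" for i t
  have contv: "continuous_on UNIV (v i)" for i
    unfolding v_def using Pa by (cases "i = Suc n") (auto intro!: continuous_intros contP cont)
  have "t ^ k - (\<Sum>i=1..Suc n. X i ^ k * v i t) = divdiff X (Suc n) k t * (\<Prod>i=1..Suc n. t - X i)" for k t
  proof -
    have "(\<Sum>i=1..Suc n. X i ^ k * v i t)
        = (\<Sum>i=1..n. X i ^ k * u i t - P t / P a * (X i ^ k * u i a)) + a ^ k * (P t / P a)"
      by (simp add: v_def a_def[symmetric] algebra_simps)
    also have "\<dots> = (\<Sum>i=1..n. X i ^ k * u i t) - P t / P a * (\<Sum>i=1..n. X i ^ k * u i a) + a ^ k * (P t / P a)"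
      by (simp only: sum_subtractf sum_distrib_left)
    finally have "t ^ k - (\<Sum>i=1..Suc n. X i ^ k * v i t)
        = (t ^ k - (\<Sum>i=1..n. X i ^ k * u i t)) - P t / P a * (a ^ k - (\<Sum>i=1..n. X i ^ k * u i a))"
      by (simp add: algebra_simps)
    also have "\<dots> = P t * (divdiff X n k t - divdiff X n k a)"
      unfolding u P_def[symmetric] using Pa by (simp add: field_simps)
    also have "\<dots> = P t * ((t - a) * divdiff X (Suc n) k t)"
      unfolding a_def divdiff_diff ..
    also have "\<dots> = divdiff X (Suc n) k t * (\<Prod>i=1..Suc n. t - X i)"
      by (simp add: P_def a_def)
    finally show ?thesis .
  qed
  then show ?case using contv by blast
qed

section \<open>The Laguerre sum\<close>

text \<open>The derivative of left minus right side is \<open>ln (1 - h\<^sup>2)\<close>.\<close>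

lemma entropy_diff_le:
  fixes h :: real
  assumes "0 \<le> h" "h < 1"
  shows "(1 + h) * ln (1 + h) - (1 - h) * ln (1 - h) \<le> 2 * h"
proof -
  define g where "g h = (1 + h) * ln (1 + h) - (1 - h) * ln (1 - h) - 2 * h" for h :: real
  have "g h \<le> g 0"
  proof (rule DERIV_nonpos_imp_nonincreasing[OF assms(1)])
    fix x assume x: "0 \<le> x" "x \<le> h"
    have "x * x < 1" using mult_strict_mono[of x 1 x 1] x assms by simp
    have "(g has_real_derivative (ln (1 + x) + ln (1 - x))) (at x)"
      unfolding g_def using x assms by (auto intro!: derivative_eq_intros)
    moreover have "ln (1 + x) + ln (1 - x) = ln ((1 + x) * (1 - x))"
      using x assms by (subst ln_mult_pos) auto
    moreover have "\<dots> \<le> 0"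
      using x assms \<open>x * x < 1\<close> by (subst ln_le_zero_iff) (auto simp: algebra_simps)
    ultimately show "\<exists>y. (g has_real_derivative y) (at x) \<and> y \<le> 0" by auto
  qed
  then show ?thesis by (simp add: g_def)
qed

text \<open>Stirling's formula centred at \<open>j + 1/2\<close>. The quotient of \<open>j!\<close> by
  \<open>((j + 1/2) / e) powr (j + 1/2)\<close> increases to \<open>sqrt (2 * pi)\<close>, so its value at \<open>j = 0\<close>, which is
  \<open>sqrt (2 * e)\<close>, is a lower bound. In the step, \<open>m = j + 1\<close> lies halfway between
  the two centres \<open>m - 1/2\<close> and \<open>m + 1/2\<close>.\<close>

lemma fact_ge_midpoint_stirling:
  "sqrt (2 * exp 1) * ((real j + 1/2) / exp 1) powr (real j + 1/2) \<le> fact j"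
proof (induction j)
  case 0
  have "sqrt (2 * exp 1) * ((1/2) / exp 1 :: real) powr (1/2) = 1"
    by (simp add: powr_half_sqrt real_sqrt_mult[symmetric])
  then show ?case by simp
next
  case (Suc j)
  define m where "m = real j + 1"
  define h where "h = 1 / (2 * m)"
  have m: "m \<ge> 1" by (simp add: m_def)
  have h: "0 \<le> h" "h < 1" using m by (auto simp: h_def field_simps)
  have mh: "m * (1 + h) = m + 1/2" "m * (1 - h) = m - 1/2"
    using m by (auto simp: h_def field_simps)
  have l1: "ln (m + 1/2) = ln m + ln (1 + h)"
    unfolding mh[symmetric] using m h by (subst ln_mult_pos) auto
  have l2: "ln (m - 1/2) = ln m + ln (1 - h)"
    unfolding mh[symmetric] using m h by (subst ln_mult_pos) auto
  have "m * ((1 + h) * ln (1 + h) - (1 - h) * ln (1 - h)) \<le> m * (2 * h)"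
    using m entropy_diff_le[OF h] by (intro mult_left_mono) auto
  also have "m * (2 * h) = 1" using m by (simp add: h_def)
  finally have "(m * (1 + h)) * ln (1 + h) - (m * (1 - h)) * ln (1 - h) \<le> 1"
    by (simp add: algebra_simps)
  then have key: "(m + 1/2) * (ln (m + 1/2) - 1) \<le> ln m + (m - 1/2) * (ln (m - 1/2) - 1)"
    unfolding mh l1 l2 by (simp add: algebra_simps)
  have "((m + 1/2) / exp 1) powr (m + 1/2) = exp ((m + 1/2) * (ln (m + 1/2) - 1))"
    using m by (simp add: powr_def ln_div algebra_simps)
  also have "\<dots> \<le> exp (ln m + (m - 1/2) * (ln (m - 1/2) - 1))" using key by simp
  also have "\<dots> = m * ((m - 1/2) / exp 1) powr (m - 1/2)"
    using m by (simp add: powr_def ln_div exp_add)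
  finally have "sqrt (2 * exp 1) * ((m + 1/2) / exp 1) powr (m + 1/2)
      \<le> m * (sqrt (2 * exp 1) * ((m - 1/2) / exp 1) powr (m - 1/2))"
    by (simp add: mult_left_mono mult.left_commute)
  also have "\<dots> \<le> m * fact j"
    using Suc m by (intro mult_left_mono) (auto simp: m_def add.commute)
  also have "\<dots> = fact (Suc j)" by (simp add: m_def)
  finally show ?case by (simp add: m_def algebra_simps)
qed

text \<open>The terms of the exponential series at \<open>y\<close> are largest near \<open>j = y\<close>, where each is smaller
  than the whole sum by a factor of order \<open>sqrt y\<close>. The exponent \<open>t = j + 1/2\<close> absorbs this
  factor: \<open>y powr t * exp (- y)\<close> is maximal at \<open>y = t\<close>.\<close>

lemma power_div_fact_le:
  fixes y :: real
  assumes "y > 0"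
  shows "y ^ j / fact j \<le> exp y / sqrt (2 * exp 1 * y)"
proof -
  define t where "t = real j + 1/2"
  have t: "t > 0" by (simp add: t_def)
  have "ln (y / t) \<le> y / t - 1" using assms t by (intro ln_le_minus_one) auto
  then have "t * (ln y - ln t) \<le> y - t"
    using assms t by (simp add: ln_div field_simps)
  then have "exp (t * ln y - y) \<le> exp (t * (ln t - 1))"
    by (simp add: algebra_simps)
  also have "\<dots> = (t / exp 1) powr t"
    using t by (simp add: powr_def ln_div)
  also have "\<dots> \<le> fact j / sqrt (2 * exp 1)"
    using fact_ge_midpoint_stirling[of j] unfolding t_def[symmetric]
    by (simp add: pos_le_divide_eq mult.commute)
  finally have "exp (t * ln y) \<le> exp y * fact j / sqrt (2 * exp 1)"
    by (simp add: exp_diff field_simps)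
  moreover have "exp (t * ln y) = y ^ j * sqrt y"
    using assms by (simp add: t_def distrib_right exp_add powr_realpow[symmetric] powr_half_sqrt[symmetric] powr_def)
  ultimately show ?thesis
    using assms by (simp add: real_sqrt_mult field_simps)
qed

lemma choose_power_sums:
  fixes q :: real
  assumes "\<bar>q\<bar> < 1"
  shows "(\<lambda>j. real ((n + j) choose j) * q ^ j) sums (1 / (1 - q) ^ Suc n)"
proof -
  have "(\<lambda>j. ((- real (Suc n)) gchoose j) * (-q) ^ j) sums (1 + (-q)) powr (- real (Suc n))"
    using assms by (intro gen_binomial_real) auto
  moreover have "((- real (Suc n)) gchoose j) * (-q) ^ j = real ((n + j) choose j) * q ^ j" for j
  proof -
    have "((- real (Suc n)) gchoose j) = (-1) ^ j * ((real (Suc n) + real j - 1) gchoose j)"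
      by (rule gbinomial_minus)
    also have "real (Suc n) + real j - 1 = real (n + j)" by simp
    finally have "((- real (Suc n)) gchoose j) * (-q) ^ j
        = real ((n + j) choose j) * ((-1) ^ j * (-q) ^ j)"
      by (simp only: binomial_gbinomial mult_ac)
    also have "(-1) ^ j * (-q) ^ j = q ^ j" by (simp only: power_mult_distrib[symmetric]) simp
    finally show ?thesis .
  qed
  moreover have "(1 + (-q)) powr (- real (Suc n)) = 1 / (1 - q) ^ Suc n"
    using assms by (simp only: powr_minus_divide) (simp add: powr_realpow del: of_nat_Suc power_Suc)
  ultimately show ?thesis by simp
qed


lemma minus_ln_one_minus_le:
  fixes q :: real
  assumes "0 \<le> q" "q \<le> 1 / 2"
  shows "- ln (1 - q) \<le> q + q\<^sup>2 / 2 + q ^ 3"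
proof -
  define g where "g q = q + q\<^sup>2 / 2 + q ^ 3 + ln (1 - q)" for q :: real
  have "g 0 \<le> g q"
  proof (rule DERIV_nonneg_imp_nondecreasing[OF assms(1)])
    fix x assume x: "0 \<le> x" "x \<le> q"
    have "(g has_real_derivative (1 + x + 3 * x\<^sup>2 - 1 / (1 - x))) (at x)"
      unfolding g_def using x assms by (auto intro!: derivative_eq_intros)
    moreover have "1 + x + 3 * x\<^sup>2 - 1 / (1 - x) = x\<^sup>2 * (2 - 3 * x) / (1 - x)"
      using x assms by (simp add: field_simps power2_eq_square)
    moreover have "0 \<le> x\<^sup>2 * (2 - 3 * x) / (1 - x)"
      using x assms by (intro divide_nonneg_nonneg mult_nonneg_nonneg) auto
    ultimately show "\<exists>y. (g has_real_derivative y) (at x) \<and> 0 \<le> y" by metis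
  qed
  then show ?thesis by (simp add: g_def)
qed

lemma m_L_le_iff:
  "m_L lam \<le> x \<longleftrightarrow> 5 * lam \<le> x \<and> lam * (1 + lam / 2)\<^sup>2 \<le> x \<and> 9 / lam \<le> x"
  by (simp add: m_L_def)

text \<open>The bracket in \<open>c_L\<close> is at least 4, and half of the \<open>2 * sqrt lam\<close> in its exponent suffices.
  The left-hand side is the form in which the constant arises in the estimate of the Laguerre
  sum.\<close>

lemma c_L_ge:
  assumes "lam > 0"
  shows "exp (lam / 2 + sqrt lam) * sqrt 2 / (sqrt (exp 1) * lam powr (1/4)) \<le> c_L lam"
proof -
  define F where "F = 3 + sqrt (pi / exp 1) + 2 / (sqrt pi * lam powr (1/4)) + 7 / (16 * sqrt lam)
        + sqrt lam * (2 + lam)"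
  have "sqrt (pi / exp 1) \<ge> 1"
    using exp_le pi_gt3 by (simp add: field_simps)
  then have F: "F \<ge> 4" unfolding F_def using assms by (smt (verit) divide_nonneg_nonneg mult_nonneg_nonneg pi_ge_zero powr_ge_zero real_sqrt_ge_zero)
  have "pi \<le> 2 * exp 1" using pi_less_4 exp_ge_add_one_self[of 1] by linarith
  then have "sqrt pi \<le> sqrt 2 * sqrt (exp 1)" by (simp flip: real_sqrt_mult)
  then have "sqrt 2 * sqrt pi \<le> sqrt 2 * (sqrt 2 * sqrt (exp 1))" by (intro mult_left_mono) auto
  also have "\<dots> = 2 * sqrt (exp 1)" by simp
  finally have "sqrt 2 / sqrt (exp 1) \<le> 4 / (2 * sqrt pi)"
    by (simp add: field_simps)
  also have "\<dots> \<le> F / (2 * sqrt pi)" using F by (intro divide_right_mono) auto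
  finally have 1: "sqrt 2 / sqrt (exp 1) \<le> F / (2 * sqrt pi)" .
  have 2: "exp (lam / 2 + sqrt lam) \<le> exp (lam / 2 + 2 * sqrt lam)" using assms by simp
  have "exp (lam / 2 + sqrt lam) * (sqrt 2 / sqrt (exp 1)) / lam powr (1/4)
      \<le> exp (lam / 2 + 2 * sqrt lam) * (F / (2 * sqrt pi)) / lam powr (1/4)"
    by (intro divide_right_mono mult_mono 1 2) auto
  moreover have "c_L lam = exp (lam / 2 + 2 * sqrt lam) * (F / (2 * sqrt pi)) / lam powr (1/4)"
    unfolding c_L_def F_def[symmetric] by simp
  ultimately show ?thesis by simp
qed

lemma c_L_pos: "lam > 0 \<Longrightarrow> c_L lam > 0"
  by (rule less_le_trans[OF _ c_L_ge]) auto

text \<open>Termwise comparison with the negative binomial series at \<open>q = sqrt (lam / n)\<close>. The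
  condition \<open>5 * lam \<le> n\<close> keeps this ratio below \<open>1/2\<close>, and
  \<open>lam * (1 + lam / 2)\<^sup>2 \<le> n\<close> makes the third-order term \<open>lam * q\<close> in the
  expansion of \<open>- n * ln (1 - q)\<close> at most \<open>sqrt lam\<close>.\<close>

lemma laguerre_sum_bound:
  assumes lam: "lam > 0" and n: "m_L lam \<le> real n"
  shows "summable (\<lambda>j. lam ^ j / fact j * real ((n + j) choose j))"
    and "(\<Sum>j. lam ^ j / fact j * real ((n + j) choose j))
          \<le> c_L lam * real n powr (-1/4) * exp (2 * sqrt (lam * real n))"
proof -
  have nlam: "5 * lam \<le> real n" "lam * (1 + lam / 2)\<^sup>2 \<le> real n"
    using n by (auto simp: m_L_le_iff)
  have npos: "real n > 0" using nlam(1) lam by linarith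
  define y where "y = sqrt (lam * real n)"
  define q where "q = sqrt (lam / real n)"
  have y: "y > 0" and q0: "q > 0" using lam npos by (auto simp: y_def q_def)
  have yq: "y * q = lam" and nq: "real n * q = y" and nqq: "real n * q\<^sup>2 = lam"
  proof -
    define a b where "a = sqrt lam" and "b = sqrt (real n)"
    have ab: "lam = a * a" "real n = b * b" "b > 0" "y = a * b" "q = a / b"
      using lam npos by (auto simp: a_def b_def y_def q_def real_sqrt_mult real_sqrt_divide)
    show "y * q = lam" "real n * q = y" "real n * q\<^sup>2 = lam"
      using ab(3) by (auto simp: ab(1,2,4,5) power2_eq_square)
  qed
  have "q\<^sup>2 \<le> (1/2)\<^sup>2" using nlam(1) npos lam by (simp add: q_def field_simps power2_eq_square)
  then have q: "q \<le> 1/2" by (rule power2_le_imp_le) simp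
  \<comment> \<open>The common bound for all \<open>y ^ j / j!\<close>, which takes the power \<open>y ^ j\<close> out of \<open>lam ^ j = y ^ j * q ^ j\<close>.\<close>
  define E where "E = exp y / sqrt (2 * exp 1 * y)"
  have E: "E \<ge> 0" using y by (simp add: E_def)
  have term_le: "lam ^ j / fact j * real ((n + j) choose j) \<le> E * (real ((n + j) choose j) * q ^ j)" for j
  proof -
    have "lam ^ j / fact j = y ^ j / fact j * q ^ j" by (simp add: yq[symmetric] power_mult_distrib)
    also have "\<dots> \<le> E * q ^ j"
      unfolding E_def using power_div_fact_le[OF y] q0 by (intro mult_right_mono) auto
    finally have "lam ^ j / fact j * real ((n + j) choose j) \<le> E * q ^ j * real ((n + j) choose j)"
      by (intro mult_right_mono) auto
    then show ?thesis by (simp add: mult_ac)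
  qed
  have sums: "(\<lambda>j. E * (real ((n + j) choose j) * q ^ j)) sums (E * (1 / (1 - q) ^ Suc n))"
    using q q0 by (intro sums_mult choose_power_sums) auto
  show summ: "summable (\<lambda>j. lam ^ j / fact j * real ((n + j) choose j))"
    by (rule summable_comparison_test'[OF sums_summable[OF sums], of 0]) (use term_le lam in auto)
  have "lam * q \<le> sqrt lam"
  proof -
    have "(lam * (1 + lam / 2)\<^sup>2) / real n \<le> 1" using nlam(2) npos by simp
    then have "(q * (1 + lam / 2))\<^sup>2 \<le> 1\<^sup>2"
      using lam npos by (simp add: q_def power_mult_distrib)
    then have "q * (1 + lam / 2) \<le> 1" by (rule power2_le_imp_le) simp
    moreover have "0 \<le> (sqrt lam - 1)\<^sup>2" by simp
    then have "sqrt lam \<le> 1 + lam / 2" using lam by (simp add: power2_diff)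
    then have "q * sqrt lam \<le> q * (1 + lam / 2)" using q0 by (intro mult_left_mono) auto
    ultimately have "(q * sqrt lam) * sqrt lam \<le> 1 * sqrt lam" using lam by (intro mult_right_mono) auto
    then show ?thesis using lam by (simp add: mult_ac)
  qed
  moreover have "real n * (- ln (1 - q)) \<le> real n * (q + q\<^sup>2 / 2 + q ^ 3)"
    using q0 q by (intro mult_left_mono minus_ln_one_minus_le) auto
  moreover have "real n * (q + q\<^sup>2 / 2 + q ^ 3) = y + lam / 2 + lam * q"
    using nq nqq by (simp add: distrib_left power3_eq_cube power2_eq_square mult.assoc[symmetric])
  ultimately have lnq: "- (real n * ln (1 - q)) \<le> y + lam / 2 + sqrt lam" by simp
  have "1 / (1 - q) ^ n = exp (- (real n * ln (1 - q)))"
    using q by (simp add: exp_minus exp_of_nat_mult inverse_eq_divide)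
  also have "\<dots> \<le> exp (y + lam / 2 + sqrt lam)" using lnq by simp
  finally have "1 / (1 - q) ^ n * (1 / (1 - q)) \<le> exp (y + lam / 2 + sqrt lam) * 2"
    using q by (intro mult_mono) (auto simp: field_simps)
  then have geom: "1 / (1 - q) ^ Suc n \<le> exp (y + lam / 2 + sqrt lam) * 2" by (simp add: mult.commute)
  have "(\<Sum>j. lam ^ j / fact j * real ((n + j) choose j)) \<le> E * (1 / (1 - q) ^ Suc n)"
    using suminf_le[OF term_le summ sums_summable[OF sums]] sums_unique[OF sums] by simp
  also have "\<dots> \<le> E * (exp (y + lam / 2 + sqrt lam) * 2)"
    using geom E by (intro mult_left_mono) auto
  also have "\<dots> = exp (lam / 2 + sqrt lam) * sqrt 2 / (sqrt (exp 1) * sqrt y) * exp (2 * y)"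
  proof -
    have "exp y * exp (y + lam / 2 + sqrt lam) = exp (lam / 2 + sqrt lam) * exp (2 * y)"
      by (simp add: exp_add[symmetric])
    moreover have "2 / (sqrt 2 * sqrt (exp 1) * sqrt y) = sqrt 2 / (sqrt (exp 1) * sqrt y)"
      using y by (simp add: field_simps)
    moreover have "E * (exp (y + lam / 2 + sqrt lam) * 2)
        = (exp y * exp (y + lam / 2 + sqrt lam)) * (2 / (sqrt 2 * sqrt (exp 1) * sqrt y))"
      unfolding E_def by (simp add: real_sqrt_mult)
    ultimately show ?thesis by simp
  qed
  also have "sqrt y = lam powr (1/4) * real n powr (1/4)"
    using lam npos by (simp add: y_def powr_half_sqrt[symmetric] powr_powr powr_mult)
  also have "exp (lam / 2 + sqrt lam) * sqrt 2 / (sqrt (exp 1) * (lam powr (1/4) * real n powr (1/4)))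
      = exp (lam / 2 + sqrt lam) * sqrt 2 / (sqrt (exp 1) * lam powr (1/4)) * real n powr (-1/4)"
    using npos by (simp add: powr_minus field_simps)
  also have "\<dots> * exp (2 * y) \<le> c_L lam * real n powr (-1/4) * exp (2 * y)"
    using c_L_ge[OF lam] by (intro mult_right_mono) auto
  finally show "(\<Sum>j. lam ^ j / fact j * real ((n + j) choose j))
          \<le> c_L lam * real n powr (-1/4) * exp (2 * sqrt (lam * real n))"
    by (simp add: y_def)
qed

section \<open>Chebyshev expansions\<close>

fun chebT :: "nat \<Rightarrow> real poly" where
  "chebT 0 = 1"
| "chebT (Suc 0) = [:0, 1:]"
| "chebT (Suc (Suc n)) = [:0, 2:] * chebT (Suc n) - chebT n"

fun chebU :: "nat \<Rightarrow> real poly" where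
  "chebU 0 = 1"
| "chebU (Suc 0) = [:0, 2:]"
| "chebU (Suc (Suc n)) = [:0, 2:] * chebU (Suc n) - chebU n"

lemma poly_chebT_cos: "poly (chebT n) (cos \<theta>) = cos (real n * \<theta>)"
proof (induction n rule: chebT.induct)
  case (3 n)
  have "cos (real (Suc (Suc n)) * \<theta>) + cos (real n * \<theta>)
      = cos (real (Suc n) * \<theta> + \<theta>) + cos (real (Suc n) * \<theta> - \<theta>)"
    by (simp add: algebra_simps)
  also have "\<dots> = 2 * cos \<theta> * cos (real (Suc n) * \<theta>)"
    unfolding cos_add cos_diff by simp
  finally have "cos (real (Suc (Suc n)) * \<theta>) + cos (real n * \<theta>) = 2 * cos \<theta> * cos (real (Suc n) * \<theta>)" .
  then show ?case using 3 by (simp del: of_nat_Suc)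
qed auto

lemma poly_chebU_cos: "poly (chebU n) (cos \<theta>) * sin \<theta> = sin (real (Suc n) * \<theta>)"
proof (induction n rule: chebU.induct)
  case 2
  then show ?case by (simp add: sin_double mult.commute[of \<theta>])
next
  case (3 n)
  have "sin (real (Suc (Suc (Suc n))) * \<theta>) + sin (real (Suc n) * \<theta>)
      = sin (real (Suc (Suc n)) * \<theta> + \<theta>) + sin (real (Suc (Suc n)) * \<theta> - \<theta>)"
    by (simp add: algebra_simps)
  also have "\<dots> = 2 * cos \<theta> * sin (real (Suc (Suc n)) * \<theta>)"
    unfolding sin_add sin_diff by simp
  finally have "sin (real (Suc (Suc (Suc n))) * \<theta>) + sin (real (Suc n) * \<theta>)
      = 2 * cos \<theta> * sin (real (Suc (Suc n)) * \<theta>)" .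
  then show ?case using 3 by (simp add: algebra_simps del: of_nat_Suc)
qed auto

text \<open>Both sides satisfy the same three-term recursion. The identity makes coefficient bounds for the
  second kind carry over to the first kind.\<close>

lemma chebT_eq_chebU_diff: "smult 2 (chebT (Suc (Suc n))) = chebU (Suc (Suc n)) - chebU n"
proof -
  have "smult 2 (chebT (Suc (Suc n))) = chebU (Suc (Suc n)) - chebU n \<and>
        smult 2 (chebT (Suc (Suc (Suc n)))) = chebU (Suc (Suc (Suc n))) - chebU (Suc n)"
  proof (induction n)
    case 0
    show ?case by (simp add: one_pCons)
  next
    case (Suc n)
    \<comment> \<open>Generalised, so that the recursion unfolds only once.\<close>
    have step: "smult 2 (X * t1 - t0) = (X * u3 - u2) - (X * u1 - u0)"
      if "smult 2 t1 = u3 - u1" "smult 2 t0 = u2 - u0" for X t0 t1 u0 u1 u2 u3 :: "real poly"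
    proof -
      have "smult 2 (X * t1 - t0) = X * smult 2 t1 - smult 2 t0"
        by (simp add: smult_diff_right)
      then show ?thesis unfolding that by (simp add: algebra_simps)
    qed
    have "smult 2 (chebT (Suc (Suc (Suc (Suc n))))) = chebU (Suc (Suc (Suc (Suc n)))) - chebU (Suc (Suc n))"
      unfolding chebT.simps(3)[of "Suc (Suc n)"] chebU.simps(3)[of "Suc (Suc n)"]
        chebU.simps(3)[of "n"] using Suc by (intro step) auto
    then show ?case using Suc by blast
  qed
  then show ?thesis ..
qed

text \<open>The exact modulus of the coefficient; the recursion becomes Pascal's rule once the alternating
  signs are discarded by the triangle inequality.\<close>

lemma coeff_chebU_bound:
  "\<bar>coeff (chebU n) k\<bar> \<le> (if even (n + k) then 2 ^ k * real (((n + k) div 2) choose k) else 0)"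
proof (induction n arbitrary: k rule: chebU.induct)
  case 1
  then show ?case by (cases k) (auto simp: one_pCons)
next
  case 2
  then show ?case
    by (cases k; cases "k - 1") (auto simp: numeral_2_eq_2)
next
  case (3 n)
  show ?case
  proof (cases k)
    case 0
    then show ?thesis using "3.IH"(2)[of 0] by auto
  next
    case (Suc l)
    have "coeff (chebU (Suc (Suc n))) k = 2 * coeff (chebU (Suc n)) l - coeff (chebU n) k"
      by (simp add: Suc)
    then have le: "\<bar>coeff (chebU (Suc (Suc n))) k\<bar> \<le> 2 * \<bar>coeff (chebU (Suc n)) l\<bar> + \<bar>coeff (chebU n) k\<bar>"
      by linarith
    show ?thesis
    proof (cases "even (n + k)")
      case True
      then obtain m where m: "n + k = 2 * m" by blast
      have "\<bar>coeff (chebU (Suc n)) l\<bar> \<le> 2 ^ l * real (m choose l)"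
      proof -
        have "Suc n + l = 2 * m" using m Suc by simp
        then show ?thesis using "3.IH"(1)[of l] by simp
      qed
      moreover have "\<bar>coeff (chebU n) k\<bar> \<le> 2 ^ k * real (m choose k)"
        using "3.IH"(2)[of k] m by simp
      moreover have "(Suc (Suc n) + k) div 2 = Suc m" using m by simp
      ultimately show ?thesis using le m Suc by (simp add: algebra_simps)
    next
      case False
      then show ?thesis using "3.IH"(1)[of l] "3.IH"(2)[of k] le Suc by simp
    qed
  qed
qed

lemma coeff_chebT_bound:
  assumes "n > 0"
  shows "\<bar>coeff (chebT n) k\<bar> \<le>
    (if even (n + k) then 2 ^ k / 2 * (real (((n + k) div 2) choose k) + real (((n + k) div 2 - 1) choose k)) else 0)"
proof -
  consider "n = 1" | m where "n = Suc (Suc m)"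
    using assms by (cases n; cases "n - 1") auto
  then show ?thesis
  proof cases
    case 1
    then show ?thesis by (cases k; cases "k - 1") (auto simp: numeral_2_eq_2)
  next
    case 2
    have "2 * coeff (chebT n) k = coeff (chebU n) k - coeff (chebU m) k"
      using chebT_eq_chebU_diff[of m] unfolding 2 by (metis coeff_diff coeff_smult)
    then have "2 * \<bar>coeff (chebT n) k\<bar> \<le> \<bar>coeff (chebU n) k\<bar> + \<bar>coeff (chebU m) k\<bar>" by linarith
    then show ?thesis
      using coeff_chebU_bound[of n k] coeff_chebU_bound[of m k] 2 by (auto simp: algebra_simps split: if_splits)
  qed
qed

lemma degree_chebU: "degree (chebU n) = n" and lead_coeff_chebU: "coeff (chebU n) n = 2 ^ n"
proof -
  have "degree (chebU n) \<le> n \<and> coeff (chebU n) n = 2 ^ n"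
  proof (induction n rule: chebU.induct)
    case (3 n)
    have "coeff (chebU n) (Suc (Suc n)) = 0" using 3 by (intro coeff_eq_0) auto
    then show ?case using 3
      by (auto simp del: of_nat_Suc intro!: degree_diff_le order_trans[OF degree_mult_le] degree_pCons_le)
  qed (auto simp: one_pCons)
  moreover from this have "n \<le> degree (chebU n)" by (intro le_degree) auto
  ultimately show "degree (chebU n) = n" "coeff (chebU n) n = 2 ^ n" by auto
qed

lemma degree_chebT: "degree (chebT n) = n" and lead_coeff_chebT: "coeff (chebT n) n = (if n = 0 then 1 else 2 ^ (n - 1))"
proof -
  have "degree (chebT n) \<le> n \<and> coeff (chebT n) n = (if n = 0 then 1 else 2 ^ (n - 1))"
  proof (induction n rule: chebT.induct)
    case (3 n)
    have "coeff (chebT n) (Suc (Suc n)) = 0" using 3 by (intro coeff_eq_0) auto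
    then show ?case using 3
      by (auto simp del: of_nat_Suc intro!: degree_diff_le order_trans[OF degree_mult_le] degree_pCons_le)
  qed (auto simp: one_pCons)
  moreover from this have "n \<le> degree (chebT n)" by (intro le_degree) auto
  ultimately show "degree (chebT n) = n" "coeff (chebT n) n = (if n = 0 then 1 else 2 ^ (n - 1))" by auto
qed

lemma graded_basis_expansion:
  fixes B :: "nat \<Rightarrow> real poly"
  assumes deg: "\<And>j. degree (B j) = j" and lead: "\<And>j. coeff (B j) j \<noteq> 0"
    and "degree P \<le> n"
  shows "\<exists>a. P = (\<Sum>j\<le>n. smult (a j) (B j))"
  using assms(3)
proof (induction n arbitrary: P)
  case 0
  define c where "c = coeff P 0 / coeff (B 0) 0"
  have "P = smult c (B 0)"
  proof (rule poly_eqI)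
    fix k show "coeff P k = coeff (smult c (B 0)) k"
      using 0 deg[of 0] lead[of 0] by (cases "k = 0") (auto simp: c_def coeff_eq_0)
  qed
  then show ?case by (intro exI[of _ "\<lambda>_. c"]) auto
next
  case (Suc n)
  define c where "c = coeff P (Suc n) / coeff (B (Suc n)) (Suc n)"
  define Q where "Q = P - smult c (B (Suc n))"
  have "coeff Q i = 0" if "n < i" for i
    using that Suc.prems deg[of "Suc n"] lead[of "Suc n"]
    by (cases "i = Suc n") (auto simp: Q_def c_def coeff_eq_0)
  then have "degree Q \<le> n" by (intro degree_le) auto
  from Suc.IH[OF this] obtain a where a: "Q = (\<Sum>j\<le>n. smult (a j) (B j))" by blast
  have "P = (\<Sum>j\<le>Suc n. smult ((a(Suc n := c)) j) (B j))"
  proof -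
    have "P = Q + smult c (B (Suc n))" by (simp add: Q_def)
    also have "Q = (\<Sum>j\<le>n. smult ((a(Suc n := c)) j) (B j))" unfolding a by (intro sum.cong) auto
    finally show ?thesis by simp
  qed
  then show ?case by blast
qed

text \<open>A polynomial in \<open>cos \<theta>\<close> is a cosine sum, and times \<open>sin \<theta>\<close> it is a sine sum.\<close>

lemma poly_eq_trig_sum:
  assumes "degree P \<le> n"
  obtains a where "P = (\<Sum>j\<le>n. smult (a j) (chebT j))"
    "\<And>\<theta>. poly P (cos \<theta>) = (\<Sum>j\<le>n. a j * cos (real j * \<theta>))"
proof -
  obtain a where a: "P = (\<Sum>j\<le>n. smult (a j) (chebT j))"
    using graded_basis_expansion[of chebT, OF degree_chebT _ assms] lead_coeff_chebT
    by (metis power_not_zero zero_neq_numeral zero_neq_one)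
  show ?thesis by (rule that[OF a]) (simp add: a poly_sum poly_chebT_cos)
qed

lemma poly_times_sin_eq_sine_sum:
  assumes "degree P \<le> n"
  obtains b where "P = (\<Sum>j\<le>n. smult (b j) (chebU j))"
    "\<And>\<theta>. poly P (cos \<theta>) * sin \<theta> = (\<Sum>j\<le>n. b j * sin (real (Suc j) * \<theta>))"
proof -
  obtain b where b: "P = (\<Sum>j\<le>n. smult (b j) (chebU j))"
    using graded_basis_expansion[of chebU, OF degree_chebU _ assms] by (auto simp: lead_coeff_chebU)
  show ?thesis
    by (rule that[OF b]) (simp add: b poly_sum sum_distrib_right mult.assoc poly_chebU_cos del: of_nat_Suc)
qed

section \<open>Orthogonality in the angle variable\<close>

lemma has_integral_cos_multiple:
  "((\<lambda>\<theta>. cos (of_int m * \<theta>)) has_integral (if m = 0 then pi else 0)) {0..pi}"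
proof (cases "m = 0")
  case True
  then show ?thesis using has_integral_const_real[of "1::real" 0 pi] by simp
next
  case False
  have "((\<lambda>\<theta>. cos (of_int m * \<theta>)) has_integral
      (sin (of_int m * pi) / of_int m - sin (of_int m * 0) / of_int m)) {0..pi}"
  proof (rule fundamental_theorem_of_calculus)
    show "((\<lambda>\<theta>. sin (of_int m * \<theta>) / of_int m) has_vector_derivative cos (of_int m * x)) (at x within {0..pi})" for x
      unfolding has_real_derivative_iff_has_vector_derivative[symmetric]
      using False by (auto intro!: derivative_eq_intros)
  qed simp
  moreover have "sin (of_int m * pi) = 0" by (simp add: sin_zero_iff_int2) 
  ultimately show ?thesis using False by simp
qed

lemma has_integral_cos_cos:
  "((\<lambda>\<theta>. cos (real i * \<theta>) * cos (real j * \<theta>)) has_integral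
     (if i = j then if i = 0 then pi else pi / 2 else 0)) {0..pi}"
proof -
  have "((\<lambda>\<theta>. (cos (of_int (int i - int j) * \<theta>) + cos (of_int (int i + int j) * \<theta>)) / 2) has_integral
     ((if int i - int j = 0 then pi else 0) + (if int i + int j = 0 then pi else 0)) / 2) {0..pi}"
    by (intro has_integral_divide has_integral_add has_integral_cos_multiple)
  moreover have "(cos (of_int (int i - int j) * \<theta>) + cos (of_int (int i + int j) * \<theta>)) / 2
      = cos (real i * \<theta>) * cos (real j * \<theta>)" for \<theta>
    by (simp add: cos_times_cos algebra_simps)
  moreover have "((if int i - int j = 0 then pi else 0) + (if int i + int j = 0 then pi else 0)) / 2
     = (if i = j then if i = 0 then pi else pi / 2 else 0)" by auto
  ultimately show ?thesis by simp
qed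

lemma has_integral_sin_sin:
  "((\<lambda>\<theta>. sin (real (Suc i) * \<theta>) * sin (real (Suc j) * \<theta>)) has_integral (if i = j then pi / 2 else 0)) {0..pi}"
proof -
  have "((\<lambda>\<theta>. (cos (of_int (int i - int j) * \<theta>) - cos (of_int (int i + int j + 2) * \<theta>)) / 2) has_integral
     ((if int i - int j = 0 then pi else 0) - (if int i + int j + 2 = 0 then pi else 0)) / 2) {0..pi}"
    by (intro has_integral_divide has_integral_diff has_integral_cos_multiple)
  moreover have "(cos (of_int (int i - int j) * \<theta>) - cos (of_int (int i + int j + 2) * \<theta>)) / 2
      = sin (real (Suc i) * \<theta>) * sin (real (Suc j) * \<theta>)" for \<theta>
    by (simp add: sin_times_sin algebra_simps)
  moreover have "((if int i - int j = 0 then pi else 0) - (if int i + int j + 2 = 0 then pi else 0)) / 2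
     = (if i = j then pi / 2 else 0)" by auto
  ultimately show ?thesis by simp
qed

text \<open>Parseval's identity for finite sums over an orthogonal system.\<close>

lemma has_integral_orthogonal_sum_square:
  fixes e :: "nat \<Rightarrow> real \<Rightarrow> real"
  assumes "\<And>i j. ((\<lambda>\<theta>. e i \<theta> * e j \<theta>) has_integral (if i = j then w i else 0)) S"
  shows "((\<lambda>\<theta>. (\<Sum>j\<le>n. a j * e j \<theta>)\<^sup>2) has_integral (\<Sum>j\<le>n. w j * (a j)\<^sup>2)) S"
proof -
  have "((\<lambda>\<theta>. \<Sum>i\<le>n. \<Sum>j\<le>n. a i * a j * (e i \<theta> * e j \<theta>)) has_integral
      (\<Sum>i\<le>n. \<Sum>j\<le>n. a i * a j * (if i = j then w i else 0))) S"
    by (intro has_integral_sum has_integral_mult_right assms) auto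
  moreover have "(\<Sum>i\<le>n. \<Sum>j\<le>n. a i * a j * (e i \<theta> * e j \<theta>)) = (\<Sum>j\<le>n. a j * e j \<theta>)\<^sup>2" for \<theta>
    by (simp add: power2_eq_square sum_product mult_ac)
  moreover have "(\<Sum>i\<le>n. \<Sum>j\<le>n. a i * a j * (if i = j then w i else 0)) = (\<Sum>j\<le>n. w j * (a j)\<^sup>2)"
    by (simp add: if_distrib[of "\<lambda>x. _ * x"] sum.delta power2_eq_square mult_ac cong: if_cong)
  ultimately show ?thesis by simp
qed


section \<open>Factorially weighted coefficients\<close>

lemma square_two_power: "(2 ^ k)\<^sup>2 = (4 ^ k :: real)"
  by (simp add: power2_eq_square flip: power_mult_distrib)

text \<open>Logarithmic convexity of the factorial, read off from the maximality of the central binomial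
  coefficient.\<close>

lemma fact_square_le:
  assumes "d \<le> a"
  shows "(fact a)\<^sup>2 \<le> (fact (a + d) * fact (a - d) :: real)"
proof -
  have eq: "2 * a - (a + d) = a - d" "2 * a - a = a" using assms by auto
  have "real ((2 * a) choose (a + d)) \<le> real ((2 * a) choose a)"
    using binomial_maximum' by simp
  then show ?thesis
    using assms by (simp add: binomial_fact eq field_simps power2_eq_square)
qed

text \<open>The factorials in the weight and in the binomial coefficient combine to
  \<open>((n - m)!)\<^sup>2 / (n! * (n - 2 * m)!)\<close>, which log-convexity bounds by 1.\<close>

lemma coeff_chebU_weight:
  assumes "2 * m \<le> n"
  shows "fact (n - 2 * m) / fact n * (coeff (chebU n) (n - 2 * m))\<^sup>2 \<le> 4 ^ n / 16 ^ m / (fact m)\<^sup>2"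
proof -
  define k where "k = n - 2 * m"
  have k: "n = k + 2 * m" using assms by (simp add: k_def)
  have "\<bar>coeff (chebU n) k\<bar> \<le> 2 ^ k * real ((k + m) choose k)"
    using coeff_chebU_bound[of n k] by (simp add: k)
  then have "(coeff (chebU n) k)\<^sup>2 \<le> (2 ^ k * real ((k + m) choose k))\<^sup>2"
    using abs_le_square_iff by fastforce
  also have "\<dots> = 4 ^ k * (fact (k + m))\<^sup>2 / ((fact k)\<^sup>2 * (fact m)\<^sup>2)"
    by (simp add: binomial_fact power_mult_distrib power_divide square_two_power)
  finally have "fact k / fact n * (coeff (chebU n) k)\<^sup>2
      \<le> fact k / fact n * (4 ^ k * (fact (k + m))\<^sup>2 / ((fact k)\<^sup>2 * (fact m)\<^sup>2))"
    by (intro mult_left_mono) auto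
  also have "\<dots> = 4 ^ k / (fact m)\<^sup>2 * ((fact (k + m))\<^sup>2 / (fact n * fact k))"
    by (simp add: field_simps power2_eq_square)
  also have "\<dots> \<le> 4 ^ k / (fact m)\<^sup>2 * 1"
    using fact_square_le[of m "k + m"] by (intro mult_left_mono) (auto simp: k divide_le_eq_1 mult_2 add.assoc)
  also have "(4 :: real) ^ k = 4 ^ n / 16 ^ m"
    by (simp add: k power_add power_mult)
  finally show ?thesis by (simp add: k_def)
qed

text \<open>As for the second kind, with the additional factor \<open>n / (n - 1) \<le> 2\<close> for \<open>m > 0\<close>. The leading
  coefficient \<open>m = 0\<close> must not lose this factor: it is the dominant one, and its constant enters
  the bound for the supremum norm.\<close>

lemma coeff_chebT_weight:
  assumes n: "n > 0" and m: "2 * m \<le> n"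
  shows "fact (n - 2 * m) / fact n * (coeff (chebT n) (n - 2 * m))\<^sup>2
    \<le> (if m = 0 then 1 else 2) * (4 ^ n / 4) / 16 ^ m / (fact m)\<^sup>2"
proof (cases m)
  case 0
  obtain l where l: "n = Suc l" using n by (cases n) auto
  have "(coeff (chebT n) n)\<^sup>2 = 4 ^ n / 4"
    unfolding lead_coeff_chebT by (simp add: l square_two_power)
  then show ?thesis using 0 by simp
next
  case (Suc d)
  define k where "k = n - 2 * m"
  have k: "n = k + 2 * m" using assms by (simp add: k_def)
  define \<beta> where "\<beta> = real n * fact (k + d) / (fact k * fact m)"
  \<comment> \<open>The two terms have ratio \<open>k + m\<close> to \<open>m\<close>, and \<open>n = k + 2 * m\<close>.\<close>
  have "real ((k + m) choose k) + real ((k + m - 1) choose k) = \<beta>"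
  proof -
    have "real ((k + m) choose k) = (real k + real m) * fact (k + d) / (fact k * fact m)"
      by (simp add: binomial_fact Suc add.commute)
    moreover have "real ((k + m - 1) choose k) = real m * fact (k + d) / (fact k * fact m)"
    proof -
      have "k + m - 1 = k + d" "fact m = real m * fact d" "real m > 0" by (simp_all add: Suc)
      then show ?thesis by (simp add: binomial_fact)
    qed
    ultimately show ?thesis by (simp add: \<beta>_def k add_divide_distrib[symmetric] algebra_simps)
  qed
  then have "\<bar>coeff (chebT n) k\<bar> \<le> 2 ^ k / 2 * \<beta>"
    using coeff_chebT_bound[OF n, of k] by (simp add: k)
  then have "(coeff (chebT n) k)\<^sup>2 \<le> (2 ^ k / 2 * \<beta>)\<^sup>2"
    using abs_le_square_iff by fastforce
  also have "\<dots> = 4 ^ k / 4 * \<beta>\<^sup>2"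
    by (simp add: power_mult_distrib power_divide square_two_power)
  finally have "fact k / fact n * (coeff (chebT n) k)\<^sup>2 \<le> fact k / fact n * (4 ^ k / 4 * \<beta>\<^sup>2)"
    by (intro mult_left_mono) auto
  also have "\<dots> = 4 ^ k / 4 / (fact m)\<^sup>2 * (real n / real (n - 1)) *
      ((fact (k + d))\<^sup>2 / (fact (k + 2 * d) * fact k))"
  proof -
    define R F where "R = real (n - 1)" and "F = (fact (k + 2 * d) :: real)"
    have "fact n = real n * (R * F)" and "R > 0" "F > 0"
      by (simp_all add: k Suc R_def F_def)
    then show ?thesis unfolding R_def[symmetric] F_def[symmetric]
      using n by (simp add: \<beta>_def field_simps power2_eq_square)
  qed
  also have "\<dots> \<le> 4 ^ k / 4 / (fact m)\<^sup>2 * 2 * 1"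
  proof (intro mult_mono mult_left_mono)
    show "real n / real (n - 1) \<le> 2" by (simp add: k Suc divide_le_eq)
    show "(fact (k + d))\<^sup>2 / (fact (k + 2 * d) * fact k) \<le> (1 :: real)"
      using fact_square_le[of d "k + d"] by (simp add: divide_le_eq_1 mult_2 add.assoc)
  qed auto
  also have "(4 :: real) ^ k = 4 ^ n / 16 ^ m"
    by (simp add: k power_add power_mult)
  finally show ?thesis using Suc by (simp add: k_def)
qed

lemma sum_alternate:
  fixes g :: "nat \<Rightarrow> real"
  assumes "\<And>k. k \<le> n \<Longrightarrow> odd (n + k) \<Longrightarrow> g k = 0"
  shows "(\<Sum>k\<le>n. g k) = (\<Sum>m\<le>n div 2. g (n - 2 * m))"
proof -
  have "(\<Sum>k\<le>n. g k) = (\<Sum>k\<in>(\<lambda>m. n - 2 * m) ` {..n div 2}. g k)"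
  proof (rule sum.mono_neutral_right)
    show "\<forall>k\<in>{..n} - (\<lambda>m. n - 2 * m) ` {..n div 2}. g k = 0"
    proof
      fix k assume k: "k \<in> {..n} - (\<lambda>m. n - 2 * m) ` {..n div 2}"
      have "odd (n + k)"
      proof
        assume "even (n + k)"
        then have "k = n - 2 * ((n - k) div 2)" using k by auto
        moreover have "(n - k) div 2 \<in> {..n div 2}" by auto
        ultimately show False using k by blast
      qed
      then show "g k = 0" using assms k by auto
    qed
  qed auto
  also have "\<dots> = (\<Sum>m\<le>n div 2. g (n - 2 * m))"
    by (subst sum.reindex) (auto simp: inj_on_def)
  finally show ?thesis .
qed

text \<open>Only coefficients with the parity of the degree contribute, and each step down by two in
  the degree contributes \<open>lam\<^sup>2\<close> from the weight and \<open>1 / 16\<close> from the squared powers of 2 in the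
  coefficients.\<close>

lemma weighted_parity_sum_le:
  fixes c r :: "nat \<Rightarrow> real"
  assumes lam: "lam > 0"
    and odd: "\<And>k. odd (n + k) \<Longrightarrow> c k = 0"
    and le: "\<And>m. 2 * m \<le> n \<Longrightarrow> fact (n - 2 * m) / fact n * (c (n - 2 * m))\<^sup>2 \<le> r m * C / 16 ^ m / (fact m)\<^sup>2"
  shows "(\<Sum>k\<le>n. lam ^ (n - k) * (fact k / fact n) * (c k)\<^sup>2)
    \<le> C * (\<Sum>m\<le>n div 2. r m * (((lam / 4)\<^sup>2) ^ m / (fact m)\<^sup>2))"
proof -
  have "(\<Sum>k\<le>n. lam ^ (n - k) * (fact k / fact n) * (c k)\<^sup>2)
      = (\<Sum>m\<le>n div 2. lam ^ (n - (n - 2 * m)) * (fact (n - 2 * m) / fact n) * (c (n - 2 * m))\<^sup>2)"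
    by (rule sum_alternate) (use odd in auto)
  also have "\<dots> \<le> (\<Sum>m\<le>n div 2. C * (r m * (((lam / 4)\<^sup>2) ^ m / (fact m)\<^sup>2)))"
  proof (rule sum_mono)
    fix m assume "m \<in> {..n div 2}"
    then have m: "2 * m \<le> n" by auto
    have "lam ^ (2 * m) * (fact (n - 2 * m) / fact n * (c (n - 2 * m))\<^sup>2)
        \<le> lam ^ (2 * m) * (r m * C / 16 ^ m / (fact m)\<^sup>2)"
      using le[OF m] lam by (intro mult_left_mono) auto
    also have "\<dots> = C * (r m * (((lam / 4)\<^sup>2) ^ m / (fact m)\<^sup>2))"
    proof -
      have "((lam / 4)\<^sup>2) ^ m = lam ^ (2 * m) / 16 ^ m" by (simp add: power_divide power_mult)
      then show ?thesis by simp
    qed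
    finally show "lam ^ (n - (n - 2 * m)) * (fact (n - 2 * m) / fact n) * (c (n - 2 * m))\<^sup>2
        \<le> C * (r m * (((lam / 4)\<^sup>2) ^ m / (fact m)\<^sup>2))"
      using m by (simp add: mult.assoc)
  qed
  finally show ?thesis by (simp add: sum_distrib_left)
qed

lemma sum_power_div_fact_le_exp:
  fixes z :: real
  assumes "z \<ge> 0"
  shows "(\<Sum>i\<le>n. z ^ i / fact i) \<le> exp z"
proof -
  have "(\<lambda>i. z ^ i / fact i) sums exp z"
    using exp_converges[of z] by (simp add: divide_inverse mult.commute)
  then show ?thesis
    using assms by (metis (no_types, lifting) divide_nonneg_nonneg fact_ge_zero finite_atMost sum_le_suminf sums_iff zero_le_power)
qed

lemma two_power_le_twice_fact: "2 ^ m \<le> (2 * fact m :: real)"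
proof (cases m)
  case (Suc l)
  have "2 ^ l \<le> (fact (Suc l) :: real)"
  proof (induction l)
    case (Suc l)
    have "2 * 2 ^ l \<le> real (Suc (Suc l)) * fact (Suc l)"
      using Suc by (intro mult_mono) auto
    then show ?case by (simp only: power_Suc fact_Suc of_nat_mult)
  qed simp
  then show ?thesis by (simp add: Suc)
qed simp

text \<open>Since \<open>2 ^ m \<le> 2 * m!\<close>, the terms are at most twice those of \<open>exp (x / 2)\<close>, and for
  \<open>m = 0\<close> exactly half of that. The halved growth rate matters: it leaves room for a further
  factor of order \<open>exp (sqrt x)\<close> within \<open>exp x\<close>.\<close>

lemma sum_power_div_fact_square_le:
  fixes x :: real
  assumes "x \<ge> 0"
  shows "(\<Sum>m\<le>n. x ^ m / (fact m)\<^sup>2) \<le> 2 * exp (x / 2) - 1"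
proof -
  have "x ^ m / (fact m)\<^sup>2 \<le> 2 * ((x / 2) ^ m / fact m) - (if m = 0 then 1 else 0)" for m
  proof (cases "m = 0")
    case False
    have "x ^ m / (fact m)\<^sup>2 = (x ^ m / (2 ^ m * (fact m)\<^sup>2)) * 2 ^ m" by simp
    also have "\<dots> \<le> (x ^ m / (2 ^ m * (fact m)\<^sup>2)) * (2 * fact m)"
      using assms by (intro mult_left_mono two_power_le_twice_fact) auto
    also have "\<dots> = 2 * ((x / 2) ^ m / fact m)"
      by (simp add: power_divide power2_eq_square)
    finally show ?thesis using False by simp
  qed simp
  then have "(\<Sum>m\<le>n. x ^ m / (fact m)\<^sup>2)
      \<le> (\<Sum>m\<le>n. 2 * ((x / 2) ^ m / fact m) - (if m = 0 then 1 else 0))"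
    by (rule sum_mono)
  also have "\<dots> = 2 * (\<Sum>m\<le>n. (x / 2) ^ m / fact m) - 1"
    by (simp add: sum_subtractf sum_distrib_left)
  also have "\<dots> \<le> 2 * exp (x / 2) - 1"
    using sum_power_div_fact_le_exp[of "x / 2" n] assms by simp
  finally show ?thesis .
qed

lemma chebU_weighted_norm_le:
  assumes "lam > 0"
  shows "(\<Sum>k\<le>n. lam ^ (n - k) * (fact k / fact n) * (coeff (chebU n) k)\<^sup>2)
    \<le> 4 ^ n * (2 * exp ((lam / 4)\<^sup>2 / 2) - 1)"
proof -
  have "(\<Sum>k\<le>n. lam ^ (n - k) * (fact k / fact n) * (coeff (chebU n) k)\<^sup>2)
      \<le> 4 ^ n * (\<Sum>m\<le>n div 2. 1 * (((lam / 4)\<^sup>2) ^ m / (fact m)\<^sup>2))"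
  proof (rule weighted_parity_sum_le[OF assms])
    show "coeff (chebU n) k = 0" if "odd (n + k)" for k
      using coeff_chebU_bound[of n k] that by simp
  qed (use coeff_chebU_weight in auto)
  also have "\<dots> \<le> 4 ^ n * (2 * exp ((lam / 4)\<^sup>2 / 2) - 1)"
    unfolding mult_1 by (intro mult_left_mono sum_power_div_fact_square_le) auto
  finally show ?thesis .
qed

lemma chebT_weighted_norm_le:
  assumes "lam > 0" and n: "n > 0"
  shows "(\<Sum>k\<le>n. lam ^ (n - k) * (fact k / fact n) * (coeff (chebT n) k)\<^sup>2)
    \<le> 4 ^ n / 4 * (2 * (2 * exp ((lam / 4)\<^sup>2 / 2) - 1) - 1)"
proof -
  let ?x = "(lam / 4)\<^sup>2"
  have "(\<Sum>k\<le>n. lam ^ (n - k) * (fact k / fact n) * (coeff (chebT n) k)\<^sup>2)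
      \<le> 4 ^ n / 4 * (\<Sum>m\<le>n div 2. (if m = 0 then 1 else 2) * (?x ^ m / (fact m)\<^sup>2))"
  proof (rule weighted_parity_sum_le[OF assms(1)])
    show "coeff (chebT n) k = 0" if "odd (n + k)" for k
      using coeff_chebT_bound[OF n, of k] that by simp
  qed (rule coeff_chebT_weight[OF n])
  also have "(\<Sum>m\<le>n div 2. (if m = 0 then 1 else 2) * (?x ^ m / (fact m)\<^sup>2))
      = (\<Sum>m\<le>n div 2. 2 * (?x ^ m / (fact m)\<^sup>2) - (if m = 0 then 1 else 0))"
    by (intro sum.cong) auto
  also have "\<dots> = 2 * (\<Sum>m\<le>n div 2. ?x ^ m / (fact m)\<^sup>2) - 1"
    by (simp add: sum_subtractf sum_distrib_left)
  also have "4 ^ n / 4 * \<dots> \<le> 4 ^ n / 4 * (2 * (2 * exp (?x / 2) - 1) - 1)"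
    using sum_power_div_fact_square_le[of ?x "n div 2"] by (intro mult_left_mono) auto
  finally show ?thesis .
qed


lemma fact_diff_div_fact_le:
  assumes "i \<le> n"
  shows "fact (n - i) / fact n \<le> (1 / fact i :: real)"
proof -
  have "real (n choose i) \<ge> 1" using assms by (simp add: Suc_le_eq)
  then show ?thesis using assms by (simp add: binomial_fact field_simps)
qed

text \<open>Transfer from the coefficients \<open>a j\<close> of an expansion in a graded basis to those in the monomial
  basis. Cauchy-Schwarz over \<open>j\<close> with weights \<open>\<gamma> j\<close> separates the two sums, and the weights
  for degree \<open>n\<close> factor through those for degree \<open>j\<close>.\<close>

lemma weighted_coeff_le:
  fixes B :: "nat \<Rightarrow> real poly"
  assumes lam: "lam > 0"
    and deg: "\<And>j. degree (B j) = j"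
    and P: "P = (\<Sum>j\<le>n. smult (a j) (B j))"
    and \<gamma>: "\<And>j. \<gamma> j > 0"
    and N: "\<And>j. (\<Sum>k\<le>j. lam ^ (j - k) * (fact k / fact j) * (coeff (B j) k)\<^sup>2) \<le> 4 ^ j * (\<gamma> j * N j)"
  shows "(\<Sum>k\<le>n. lam ^ (n - k) * (fact k / fact n) * (coeff P k)\<^sup>2)
    \<le> (\<Sum>j\<le>n. \<gamma> j * (a j)\<^sup>2) * (4 ^ n * (\<Sum>i\<le>n. (lam / 4) ^ i * (fact (n - i) / fact n) * N (n - i)))"
proof -
  define S where "S = (\<Sum>j\<le>n. \<gamma> j * (a j)\<^sup>2)"
  have S: "S \<ge> 0" unfolding S_def using \<gamma> by (intro sum_nonneg) (simp add: less_imp_le)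
  define w where "w k = lam ^ (n - k) * (fact k / fact n)" for k
  have w: "w k \<ge> 0" for k using lam by (simp add: w_def)
  have "(coeff P k)\<^sup>2 \<le> S * (\<Sum>j\<le>n. (coeff (B j) k)\<^sup>2 / \<gamma> j)" for k
  proof -
    have "coeff P k = (\<Sum>j\<le>n. (sqrt (\<gamma> j) * a j) * (coeff (B j) k / sqrt (\<gamma> j)))"
      unfolding P coeff_sum using \<gamma> by (intro sum.cong) (auto simp: less_imp_neq[symmetric])
    also have "\<dots>\<^sup>2 \<le> (\<Sum>j\<le>n. (sqrt (\<gamma> j) * a j)\<^sup>2) * (\<Sum>j\<le>n. (coeff (B j) k / sqrt (\<gamma> j))\<^sup>2)"
      by (rule Cauchy_Schwarz_ineq_sum)
    finally show ?thesis using \<gamma> by (simp add: S_def power_mult_distrib power_divide less_imp_le)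
  qed
  then have "(\<Sum>k\<le>n. w k * (coeff P k)\<^sup>2) \<le> (\<Sum>k\<le>n. w k * (S * (\<Sum>j\<le>n. (coeff (B j) k)\<^sup>2 / \<gamma> j)))"
    using w by (intro sum_mono mult_left_mono) auto
  also have "\<dots> = S * (\<Sum>k\<le>n. \<Sum>j\<le>n. w k * ((coeff (B j) k)\<^sup>2 / \<gamma> j))"
    by (simp add: sum_distrib_left mult.left_commute)
  also have "(\<Sum>k\<le>n. \<Sum>j\<le>n. w k * ((coeff (B j) k)\<^sup>2 / \<gamma> j)) = (\<Sum>j\<le>n. \<Sum>k\<le>n. w k * ((coeff (B j) k)\<^sup>2 / \<gamma> j))"
    by (rule sum.swap)
  also have "\<dots> \<le> (\<Sum>j\<le>n. 4 ^ n * ((lam / 4) ^ (n - j) * (fact j / fact n) * N j))"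
  proof (rule sum_mono)
    fix j assume "j \<in> {..n}"
    then have j: "j \<le> n" by simp
    have "(\<Sum>k\<le>n. w k * ((coeff (B j) k)\<^sup>2 / \<gamma> j)) = (\<Sum>k\<le>j. w k * ((coeff (B j) k)\<^sup>2 / \<gamma> j))"
      using j by (intro sum.mono_neutral_right) (auto simp: coeff_eq_0 deg)
    also have "\<dots> = (\<Sum>k\<le>j. lam ^ (n - j) * (fact j / fact n) / \<gamma> j * (lam ^ (j - k) * (fact k / fact j) * (coeff (B j) k)\<^sup>2))"
    proof (rule sum.cong)
      fix k assume "k \<in> {..j}"
      then have "lam ^ (n - k) = lam ^ (n - j) * lam ^ (j - k)" using j by (simp flip: power_add)
      then show "w k * ((coeff (B j) k)\<^sup>2 / \<gamma> j)
          = lam ^ (n - j) * (fact j / fact n) / \<gamma> j * (lam ^ (j - k) * (fact k / fact j) * (coeff (B j) k)\<^sup>2)"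
        by (simp add: w_def)
    qed simp
    also have "\<dots> = lam ^ (n - j) * (fact j / fact n) / \<gamma> j * (\<Sum>k\<le>j. lam ^ (j - k) * (fact k / fact j) * (coeff (B j) k)\<^sup>2)"
      by (simp only: sum_distrib_left)
    also have "\<dots> \<le> lam ^ (n - j) * (fact j / fact n) / \<gamma> j * (4 ^ j * (\<gamma> j * N j))"
      using lam \<gamma>[of j] by (intro mult_left_mono N) auto
    also have "\<dots> = (lam ^ (n - j) * 4 ^ j) * (fact j / fact n) * N j"
      using \<gamma>[of j] by simp
    also have "lam ^ (n - j) * 4 ^ j = 4 ^ n * (lam / 4) ^ (n - j)"
    proof -
      have "(4::real) ^ n = 4 ^ j * 4 ^ (n - j)" using j by (simp flip: power_add)
      then show ?thesis by (simp add: power_divide)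
    qed
    finally show "(\<Sum>k\<le>n. w k * ((coeff (B j) k)\<^sup>2 / \<gamma> j))
        \<le> 4 ^ n * ((lam / 4) ^ (n - j) * (fact j / fact n) * N j)" by (simp add: mult_ac)
  qed
  also have "\<dots> = (\<Sum>i\<le>n. 4 ^ n * ((lam / 4) ^ i * (fact (n - i) / fact n) * N (n - i)))"
    by (rule sum.reindex_bij_witness[of _ "\<lambda>i. n - i" "\<lambda>j. n - j"]) auto
  finally show ?thesis using S by (simp add: S_def w_def sum_distrib_left mult_left_mono)
qed

text \<open>After division by \<open>exp (y\<^sup>2)\<close> the critical exponent is \<open>v = y - y\<^sup>2 / 2\<close>, which never exceeds
  \<open>1/2\<close>. For \<open>y \<le> 2\<close> a quadratic bound for \<open>exp v\<close> and tangent lines for the other two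
  exponentials suffice; beyond that \<open>exp v\<close> is at most 1.\<close>

lemma exp_tradeoff:
  fixes y :: real
  assumes "y \<ge> 0"
  shows "4 * exp (y\<^sup>2 / 2 + y) - 2 * exp y - 1 \<le> (1 + 4 * y) * exp (y\<^sup>2)"
proof -
  define v where "v = y - y\<^sup>2 / 2"
  have "4 * exp v \<le> 1 + 4 * y + 2 * exp (y - y\<^sup>2) + exp (- y\<^sup>2)"
  proof (cases "y \<le> 2")
    case True
    have "v = y * (1 - y / 2)" by (simp add: v_def power2_eq_square algebra_simps)
    then have v0: "v \<ge> 0" using assms True by simp
    have v1: "2 * v \<le> 1" using zero_le_power2[of "y - 1"] by (simp add: v_def power2_eq_square algebra_simps)
    have "exp v \<le> 1 + v + v\<^sup>2" using v0 v1 by (intro exp_bound) auto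
    also have "v\<^sup>2 \<le> v / 2" using v0 v1 mult_left_mono[of "2 * v" 1 v] by (simp add: power2_eq_square)
    finally have "4 * exp v \<le> 4 + 6 * v" by simp
    moreover have "exp (y - y\<^sup>2) \<ge> 1 + (y - y\<^sup>2)" "exp (- y\<^sup>2) \<ge> 1 + (- y\<^sup>2)"
      by (rule exp_ge_add_one_self)+
    ultimately show ?thesis by (simp add: v_def algebra_simps)
  next
    case False
    then have "2 * y \<le> y * y" by (intro mult_right_mono) auto
    then have "v \<le> 0" by (simp add: v_def power2_eq_square)
    then have "exp v \<le> 1" by simp
    then have "4 * exp v \<le> 1 + 4 * y" using False by linarith
    then show ?thesis by (simp add: add_increasing2)
  qed
  then have "4 * exp v * exp (y\<^sup>2) \<le> (1 + 4 * y + 2 * exp (y - y\<^sup>2) + exp (- y\<^sup>2)) * exp (y\<^sup>2)"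
    by (intro mult_right_mono) auto
  also have "\<dots> = (1 + 4 * y) * exp (y\<^sup>2) + 2 * exp y + 1"
    by (simp add: distrib_right exp_add[symmetric] mult.assoc)
  also have "4 * exp v * exp (y\<^sup>2) = 4 * exp (y\<^sup>2 / 2 + y)"
    by (simp add: v_def exp_add[symmetric] mult.assoc)
  finally show ?thesis by simp
qed

text \<open>Parseval for the cosine sum reads \<open>(a 0)\<^sup>2 + (\<Sum>j\<ge>1. (a j)\<^sup>2) / 2 \<le> M\<^sup>2\<close>, which dictates the
  weights \<open>\<gamma>\<close>. The leading terms are tracked exactly: \<open>J\<close> bounds the Bessel type series, and
  the subtracted \<open>1/2\<close> at \<open>i = 0\<close> accounts for the sharper constant of the leading coefficient.
  Both sides of the final estimate \<open>exp_tradeoff\<close> agree in the limit \<open>lam = 0\<close>, so that none of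
  this precision can be given away.\<close>

lemma weighted_coeff_le_sup_norm:
  fixes P :: "real poly"
  assumes lam: "lam > 0" and n: "n \<ge> 1" and deg: "degree P \<le> n"
    and M: "\<And>x. x \<in> {-1..1} \<Longrightarrow> \<bar>poly P x\<bar> \<le> M"
  shows "(\<Sum>k\<le>n. lam ^ (n - k) * (fact k / fact n) * (coeff P k)\<^sup>2)
    \<le> 4 ^ n / 2 * (1 + lam) * exp (lam\<^sup>2 / 16) * M\<^sup>2"
proof -
  obtain a where P: "P = (\<Sum>j\<le>n. smult (a j) (chebT j))"
    and trig: "\<And>\<theta>. poly P (cos \<theta>) = (\<Sum>j\<le>n. a j * cos (real j * \<theta>))"
    using poly_eq_trig_sum[OF deg] by metis
  define y where "y = lam / 4"
  define J where "J = 2 * exp (y\<^sup>2 / 2) - 1"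
  define \<gamma> :: "nat \<Rightarrow> real" where "\<gamma> j = (if j = 0 then 1 else 1 / 2)" for j
  define N :: "nat \<Rightarrow> real" where "N j = (if j = 0 then 1 else (2 * J - 1) / 2)" for j
  have y: "y > 0" using lam by (simp add: y_def)
  have "exp (y\<^sup>2 / 2) \<ge> 1" by simp
  then have J: "J \<ge> 1" unfolding J_def by linarith
  have bound: "(\<Sum>k\<le>n. lam ^ (n - k) * (fact k / fact n) * (coeff P k)\<^sup>2)
    \<le> (\<Sum>j\<le>n. \<gamma> j * (a j)\<^sup>2) * (4 ^ n * (\<Sum>i\<le>n. (lam / 4) ^ i * (fact (n - i) / fact n) * N (n - i)))"
  proof (rule weighted_coeff_le[OF lam degree_chebT P])
    fix j show "(\<Sum>k\<le>j. lam ^ (j - k) * (fact k / fact j) * (coeff (chebT j) k)\<^sup>2) \<le> 4 ^ j * (\<gamma> j * N j)"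
      using chebT_weighted_norm_le[OF lam, of j]
      by (cases "j = 0") (auto simp: \<gamma>_def N_def J_def y_def)
  qed (auto simp: \<gamma>_def)
  have "((\<lambda>\<theta>. (\<Sum>j\<le>n. a j * cos (real j * \<theta>))\<^sup>2) has_integral (\<Sum>j\<le>n. (pi * \<gamma> j) * (a j)\<^sup>2)) {0..pi}"
  proof (rule has_integral_orthogonal_sum_square)
    fix i j
    have "(if i = j then if i = 0 then pi else pi / 2 else 0) = (if i = j then pi * \<gamma> i else 0)"
      by (simp add: \<gamma>_def)
    then show "((\<lambda>\<theta>. cos (real i * \<theta>) * cos (real j * \<theta>)) has_integral (if i = j then pi * \<gamma> i else 0)) {0..pi}"
      using has_integral_cos_cos[of i j] by simp
  qed
  then have "((\<lambda>\<theta>. (poly P (cos \<theta>))\<^sup>2) has_integral (\<Sum>j\<le>n. (pi * \<gamma> j) * (a j)\<^sup>2)) {0..pi}"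
    by (simp add: trig)
  moreover have "((\<lambda>\<theta>. M\<^sup>2) has_integral (pi * M\<^sup>2)) {0..pi}"
    using has_integral_const_real[of "M\<^sup>2" 0 pi] by simp
  moreover have "(poly P (cos \<theta>))\<^sup>2 \<le> M\<^sup>2" for \<theta>
    using power_mono[OF M[of "cos \<theta>"], of 2] by simp
  ultimately have "(\<Sum>j\<le>n. (pi * \<gamma> j) * (a j)\<^sup>2) \<le> pi * M\<^sup>2"
    by (rule has_integral_le)
  then have S: "(\<Sum>j\<le>n. \<gamma> j * (a j)\<^sup>2) \<le> M\<^sup>2"
    by (simp add: mult.assoc sum_distrib_left[symmetric])
  have "y ^ i * (fact (n - i) / fact n) * N (n - i) \<le> J * (y ^ i / fact i) - (if i = 0 then 1 / 2 else 0)"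
    if "i \<le> n" for i
  proof (cases "i = 0")
    case True
    then show ?thesis using n by (simp add: N_def)
  next
    case False
    have "N (n - i) \<le> J" using J by (simp add: N_def)
    then have "y ^ i * (fact (n - i) / fact n) * N (n - i) \<le> y ^ i * (1 / fact i) * J"
      using y J that by (intro mult_mono fact_diff_div_fact_le) (auto simp: N_def)
    then show ?thesis using False by (simp add: mult.commute)
  qed
  then have "(\<Sum>i\<le>n. y ^ i * (fact (n - i) / fact n) * N (n - i))
      \<le> (\<Sum>i\<le>n. J * (y ^ i / fact i) - (if i = 0 then 1 / 2 else 0))"
    by (intro sum_mono) auto
  also have "\<dots> = J * (\<Sum>i\<le>n. y ^ i / fact i) - 1 / 2"
    by (simp add: sum_subtractf sum_distrib_left)
  also have "\<dots> \<le> J * exp y - 1 / 2"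
    using J y by (intro diff_right_mono mult_left_mono sum_power_div_fact_le_exp) auto
  also have "\<dots> = (4 * exp (y\<^sup>2 / 2 + y) - 2 * exp y - 1) / 2"
    unfolding J_def exp_add by (simp add: algebra_simps diff_divide_distrib)
  also have "\<dots> \<le> (1 + lam) * exp (lam\<^sup>2 / 16) / 2"
    using exp_tradeoff[of y] y by (simp add: y_def power_divide)
  finally have T: "(\<Sum>i\<le>n. y ^ i * (fact (n - i) / fact n) * N (n - i)) \<le> (1 + lam) * exp (lam\<^sup>2 / 16) / 2" .
  have "(\<Sum>j\<le>n. \<gamma> j * (a j)\<^sup>2) * (4 ^ n * (\<Sum>i\<le>n. y ^ i * (fact (n - i) / fact n) * N (n - i)))
      \<le> M\<^sup>2 * (4 ^ n * ((1 + lam) * exp (lam\<^sup>2 / 16) / 2))"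
    using y J by (intro mult_mono S T mult_left_mono mult_nonneg_nonneg sum_nonneg) (auto simp: N_def)
  from order_trans[OF bound[folded y_def] this] show ?thesis by (simp add: mult_ac)
qed

text \<open>The substitution \<open>x = cos \<theta>\<close> produces the weight \<open>sin \<theta>\<close>. Replacing it by the smaller
  \<open>(sin \<theta>)\<^sup>2\<close> turns the integrand into the square of a sine sum, to which Parseval's identity
  applies.\<close>

lemma weighted_coeff_le_L2_norm:
  fixes P :: "real poly"
  assumes lam: "lam > 0" and deg: "degree P \<le> n"
  shows "(\<Sum>k\<le>n. lam ^ (n - k) * (fact k / fact n) * (coeff P k)\<^sup>2)
    \<le> 4 ^ n * (8 / pi) * exp (lam\<^sup>2 / 16) * integral {-1..1} (\<lambda>x. (poly P x)\<^sup>2)"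
proof -
  obtain b where P: "P = (\<Sum>j\<le>n. smult (b j) (chebU j))"
    and trig: "\<And>\<theta>. poly P (cos \<theta>) * sin \<theta> = (\<Sum>j\<le>n. b j * sin (real (Suc j) * \<theta>))"
    using poly_times_sin_eq_sine_sum[OF deg] by metis
  define y where "y = lam / 4"
  define J where "J = 2 * exp (y\<^sup>2 / 2) - 1"
  have y: "y > 0" using lam by (simp add: y_def)
  have "exp (y\<^sup>2 / 2) \<ge> 1" by simp
  then have J: "J \<ge> 1" unfolding J_def by linarith
  have bound: "(\<Sum>k\<le>n. lam ^ (n - k) * (fact k / fact n) * (coeff P k)\<^sup>2)
    \<le> (\<Sum>j\<le>n. 1 * (b j)\<^sup>2) * (4 ^ n * (\<Sum>i\<le>n. (lam / 4) ^ i * (fact (n - i) / fact n) * J))"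
    using chebU_weighted_norm_le[OF lam]
    by (intro weighted_coeff_le[OF lam degree_chebU P]) (auto simp: J_def y_def)
  let ?Q = "integral {-1..1} (\<lambda>x. (poly P x)\<^sup>2)"
  have "((\<lambda>\<theta>. (\<Sum>j\<le>n. b j * sin (real (Suc j) * \<theta>))\<^sup>2) has_integral (\<Sum>j\<le>n. pi / 2 * (b j)\<^sup>2)) {0..pi}"
    by (intro has_integral_orthogonal_sum_square has_integral_sin_sin)
  then have lower: "((\<lambda>\<theta>. (poly P (cos \<theta>) * sin \<theta>)\<^sup>2) has_integral (\<Sum>j\<le>n. pi / 2 * (b j)\<^sup>2)) {0..pi}"
    by (simp add: trig)
  have "((\<lambda>\<theta>. (- sin \<theta>) *\<^sub>R ((poly P (cos \<theta>))\<^sup>2)) has_integral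
      (integral {cos 0..cos pi} (\<lambda>x. (poly P x)\<^sup>2) - integral {cos pi..cos 0} (\<lambda>x. (poly P x)\<^sup>2))) {0..pi}"
    by (rule has_integral_substitution_general[where s = "{}" and c = "-1" and d = 1])
      (auto intro!: continuous_intros derivative_eq_intros)
  then have "((\<lambda>\<theta>. - (- sin \<theta> * (poly P (cos \<theta>))\<^sup>2)) has_integral - (- ?Q)) {0..pi}"
    by (intro has_integral_neg) simp
  then have upper: "((\<lambda>\<theta>. sin \<theta> * (poly P (cos \<theta>))\<^sup>2) has_integral ?Q) {0..pi}" by simp
  have "(\<Sum>j\<le>n. pi / 2 * (b j)\<^sup>2) \<le> ?Q"
  proof (rule has_integral_le[OF lower upper])
    fix \<theta> :: real assume "\<theta> \<in> {0..pi}"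
    then have "sin \<theta> \<ge> 0" by (intro sin_ge_zero) auto
    then have "sin \<theta> * sin \<theta> \<le> sin \<theta> * 1" by (intro mult_left_mono) auto
    then show "(poly P (cos \<theta>) * sin \<theta>)\<^sup>2 \<le> sin \<theta> * (poly P (cos \<theta>))\<^sup>2"
      using mult_right_mono[of "sin \<theta> * sin \<theta>" "sin \<theta> * 1" "(poly P (cos \<theta>))\<^sup>2"]
      by (simp add: power_mult_distrib power2_eq_square[of "sin \<theta>"] mult.commute)
  qed
  then have S: "(\<Sum>j\<le>n. 1 * (b j)\<^sup>2) \<le> 2 / pi * ?Q"
    by (simp add: sum_distrib_left[symmetric] sum_divide_distrib[symmetric] field_simps)
  have "(\<Sum>i\<le>n. y ^ i * (fact (n - i) / fact n) * J) \<le> (\<Sum>i\<le>n. y ^ i * (1 / fact i) * J)"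
    using y J by (intro sum_mono mult_right_mono mult_left_mono fact_diff_div_fact_le) auto
  also have "\<dots> = J * (\<Sum>i\<le>n. y ^ i / fact i)" by (simp add: sum_distrib_left mult_ac)
  also have "\<dots> \<le> J * exp y"
    using J y by (intro mult_left_mono sum_power_div_fact_le_exp) auto
  also have "\<dots> \<le> 2 * exp (y\<^sup>2 / 2) * exp y"
    by (intro mult_right_mono) (auto simp: J_def)
  also have "\<dots> \<le> 4 * exp (y\<^sup>2)"
  proof -
    have "0 \<le> (y - 1)\<^sup>2" by simp
    then have "y\<^sup>2 / 2 + y \<le> 1 / 2 + y\<^sup>2" by (simp add: power2_diff)
    then have "exp (y\<^sup>2 / 2) * exp y \<le> exp (1 / 2) * exp (y\<^sup>2)" by (simp flip: exp_add)
    also have "exp (1 / 2 :: real) \<le> 2"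
      by (rule power2_le_imp_le) (use exp_le in \<open>auto simp: exp_double[symmetric] power2_eq_square simp flip: exp_add\<close>)
    finally show ?thesis by (simp add: mult.commute)
  qed
  finally have T: "(\<Sum>i\<le>n. y ^ i * (fact (n - i) / fact n) * J) \<le> 4 * exp (lam\<^sup>2 / 16)"
    by (simp add: y_def power_divide)
  have "?Q \<ge> 0" by (rule integral_nonneg) (auto intro!: integrable_continuous_real continuous_intros)
  then have "(\<Sum>j\<le>n. 1 * (b j)\<^sup>2) * (4 ^ n * (\<Sum>i\<le>n. y ^ i * (fact (n - i) / fact n) * J))
      \<le> (2 / pi * ?Q) * (4 ^ n * (4 * exp (lam\<^sup>2 / 16)))"
    using y J by (intro mult_mono S T mult_left_mono mult_nonneg_nonneg sum_nonneg) auto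
  from order_trans[OF bound[folded y_def] this] show ?thesis by (simp add: mult_ac)
qed

section \<open>Node polynomials\<close>

definition node_poly :: "(nat \<Rightarrow> real) \<Rightarrow> nat \<Rightarrow> real poly" where
  "node_poly X n = (\<Prod>k=1..n. [:- X k, 1:])"

lemma poly_node_poly: "poly (node_poly X n) t = (\<Prod>k=1..n. t - X k)"
  by (simp add: node_poly_def poly_prod)

lemma node_poly_eq_0_iff: "poly (node_poly X n) t = 0 \<longleftrightarrow> t \<in> X ` {1..n}"
  by (auto simp: poly_node_poly)

lemma monic_node_poly: "degree (node_poly X n) = n" "coeff (node_poly X n) n = 1"
proof -
  have "degree (node_poly X n) = (\<Sum>k=1..n. degree [:- X k, 1:])"
    unfolding node_poly_def by (rule degree_prod_eq_sum_degree) auto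
  then show deg: "degree (node_poly X n) = n" by simp
  have "lead_coeff (node_poly X n) = (\<Prod>k=1..n. lead_coeff [:- X k, 1:])"
    unfolding node_poly_def by (rule lead_coeff_prod)
  then show "coeff (node_poly X n) n = 1" by (simp add: deg)
qed

lemma abs_node_poly_le:
  assumes "\<And>k. k \<in> {1..n} \<Longrightarrow> X k \<in> {-1..1}" "t \<in> {-1..1}"
  shows "\<bar>poly (node_poly X n) t\<bar> \<le> 2 ^ n"
proof -
  have "\<bar>poly (node_poly X n) t\<bar> = (\<Prod>k=1..n. \<bar>t - X k\<bar>)"
    by (simp add: poly_node_poly abs_prod)
  also have "\<dots> \<le> (\<Prod>k=1..n. 2)"
    using assms by (intro prod_mono) (fastforce simp: abs_le_iff)
  finally show ?thesis by simp
qed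

lemma has_integral_shifted_power:
  "((\<lambda>t. (t - a) ^ m) has_integral ((1 - a) ^ Suc m - (-1 - a) ^ Suc m) / real (Suc m)) {-1..1}"
proof -
  have "((\<lambda>t. (t - a) ^ m) has_integral
      ((1 - a) ^ Suc m / real (Suc m) - (-1 - a) ^ Suc m / real (Suc m))) {-1..1}"
  proof (rule fundamental_theorem_of_calculus)
    show "((\<lambda>t. (t - a) ^ Suc m / real (Suc m)) has_vector_derivative (x - a) ^ m) (at x within {-1..1})" for x
      unfolding has_real_derivative_iff_has_vector_derivative[symmetric]
      by (auto intro!: derivative_eq_intros simp del: power_Suc of_nat_Suc)
  qed simp
  then show ?thesis by (simp add: diff_divide_distrib)
qed

lemma power_add_le_add_power:
  fixes x y :: real
  assumes "x \<ge> 0" "y \<ge> 0"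
  shows "x ^ Suc m + y ^ Suc m \<le> (x + y) ^ Suc m"
proof -
  have "x ^ Suc m + y ^ Suc m = x * x ^ m + y * y ^ m" by simp
  also have "\<dots> \<le> x * (x + y) ^ m + y * (x + y) ^ m"
    using assms by (intro add_mono mult_left_mono power_mono) auto
  finally show ?thesis by (simp add: algebra_simps)
qed

text \<open>By the inequality of arithmetic and geometric means the integrand is at most the average of
  \<open>(t - X k) ^ (2 * n)\<close> over the nodes. Each of these integrals is largest for a node at an end
  point of the interval.\<close>

lemma integral_node_poly_square_le:
  assumes X: "\<And>k. k \<in> {1..n} \<Longrightarrow> X k \<in> {-1..1}" and n: "n \<ge> 1"
  shows "integral {-1..1} (\<lambda>t. (poly (node_poly X n) t)\<^sup>2) \<le> (2 ^ n)\<^sup>2 / real n"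
proof -
  have le: "(poly (node_poly X n) t)\<^sup>2 \<le> (\<Sum>k=1..n. (t - X k) ^ (2 * n) / real n)" for t
  proof -
    have c: "card {1..n} = n" by simp
    have "(\<Prod>k=1..n. (t - X k) ^ (2 * n)) powr (1 / real (card {1..n}))
        \<le> (\<Sum>k=1..n. (t - X k) ^ (2 * n) / real (card {1..n}))"
      using n by (intro arith_geom_mean) auto
    moreover have "(\<Prod>k=1..n. (t - X k) ^ (2 * n)) = ((poly (node_poly X n) t)\<^sup>2) powr real n"
    proof -
      have "(\<Prod>k=1..n. (t - X k) ^ (2 * n)) = ((poly (node_poly X n) t)\<^sup>2) ^ n"
        by (simp add: poly_node_poly prod_power_distrib power_mult)
      then show ?thesis using n by (simp add: powr_realpow')
    qed
    ultimately show ?thesis using n by (simp add: powr_powr c)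
  qed
  have "integral {-1..1} (\<lambda>t. (poly (node_poly X n) t)\<^sup>2)
      \<le> (\<Sum>k=1..n. ((1 - X k) ^ Suc (2 * n) - (-1 - X k) ^ Suc (2 * n)) / real (Suc (2 * n)) / real n)"
  proof (rule has_integral_le)
    show "((\<lambda>t. (poly (node_poly X n) t)\<^sup>2) has_integral integral {-1..1} (\<lambda>t. (poly (node_poly X n) t)\<^sup>2)) {-1..1}"
      by (intro integrable_integral integrable_continuous_real continuous_intros)
    show "((\<lambda>t. \<Sum>k=1..n. (t - X k) ^ (2 * n) / real n) has_integral
        (\<Sum>k=1..n. ((1 - X k) ^ Suc (2 * n) - (-1 - X k) ^ Suc (2 * n)) / real (Suc (2 * n)) / real n)) {-1..1}"
      by (intro has_integral_sum has_integral_divide has_integral_shifted_power) auto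
  qed (rule le)
  also have "\<dots> \<le> (\<Sum>k=1..n. 2 ^ Suc (2 * n) / real (Suc (2 * n)) / real n)"
  proof (intro sum_mono divide_right_mono)
    fix k assume k: "k \<in> {1..n}"
    have "(-1 - X k) ^ Suc (2 * n) = - ((1 + X k) ^ Suc (2 * n))"
      using power_minus_odd[of "Suc (2 * n)" "1 + X k"] by simp
    then have "(1 - X k) ^ Suc (2 * n) - (-1 - X k) ^ Suc (2 * n) = (1 - X k) ^ Suc (2 * n) + (1 + X k) ^ Suc (2 * n)"
      by simp
    also have "\<dots> \<le> ((1 - X k) + (1 + X k)) ^ Suc (2 * n)"
      using X[OF k] by (intro power_add_le_add_power) auto
    finally show "(1 - X k) ^ Suc (2 * n) - (-1 - X k) ^ Suc (2 * n) \<le> 2 ^ Suc (2 * n)" by simp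
  qed auto
  also have "\<dots> = 2 * (2 ^ n)\<^sup>2 / real (Suc (2 * n))"
    using n by (simp add: power_mult[symmetric] mult.commute)
  also have "\<dots> \<le> (2 ^ n)\<^sup>2 / real n"
    using n by (simp add: field_simps)
  finally show ?thesis .
qed

text \<open>The zeros of the Chebyshev polynomial of degree \<open>n\<close>, whose leading coefficient is \<open>2 ^ (n - 1)\<close>
  and which is bounded by 1 on the interval.\<close>

lemma chebyshev_nodes:
  fixes n :: nat
  assumes n: "n \<ge> 1"
  defines "X \<equiv> \<lambda>k. cos (real (2 * k - 1) * pi / real (2 * n))"
  shows "inj_on X {1..n}" "\<And>k. X k \<in> {-1..1}"
    and "\<And>t. t \<in> {-1..1} \<Longrightarrow> \<bar>poly (node_poly X n) t\<bar> \<le> 2 / 2 ^ n"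
proof -
  define \<theta> where "\<theta> k = real (2 * k - 1) * pi / real (2 * n)" for k
  have X: "X k = cos (\<theta> k)" for k by (simp add: X_def \<theta>_def)
  have \<theta>: "0 \<le> \<theta> k" "\<theta> k \<le> pi" if "k \<in> {1..n}" for k
  proof -
    have "real (2 * k - 1) * pi \<le> real (2 * n) * pi" using that by (intro mult_right_mono) auto
    then show "0 \<le> \<theta> k" "\<theta> k \<le> pi" using n by (auto simp: \<theta>_def divide_le_eq mult.commute)
  qed
  show inj: "inj_on X {1..n}"
  proof (rule inj_onI)
    fix i j assume ij: "i \<in> {1..n}" "j \<in> {1..n}" "X i = X j"
    then have "\<theta> i = \<theta> j" unfolding X using \<theta> cos_inj_pi by blast
    then show "i = j" using ij n by (auto simp: \<theta>_def)
  qed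
  show "X k \<in> {-1..1}" for k by (simp add: X)
  have root: "poly (chebT n) (X k) = 0" if k: "k \<in> {1..n}" for k
  proof -
    have "real n * \<theta> k = real (2 * k - 1) * (pi / 2)" using n by (simp add: \<theta>_def field_simps)
    then have "cos (real n * \<theta> k) = 0" unfolding cos_zero_iff using k
      by (intro disjI1 exI[of _ "2 * k - 1"]) auto
    then show ?thesis by (simp add: X poly_chebT_cos)
  qed
  have eq: "chebT n = smult (2 ^ (n - 1)) (node_poly X n)"
  proof (rule poly_eqI_degree_lead_coeff[of _ n _ "X ` {1..n}"])
    show "card (X ` {1..n}) \<ge> n" using inj by (simp add: card_image)
  qed (use n root in \<open>auto simp: monic_node_poly degree_chebT lead_coeff_chebT node_poly_eq_0_iff\<close>)
  fix t :: real assume "t \<in> {-1..1}"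
  then have "t = cos (arccos t)" by simp
  then have "\<bar>poly (chebT n) t\<bar> \<le> 1" by (metis poly_chebT_cos abs_cos_le_one)
  then have "2 ^ (n - 1) * \<bar>poly (node_poly X n) t\<bar> \<le> 1" by (simp add: eq abs_mult)
  moreover have "(2::real) ^ n = 2 * 2 ^ (n - 1)" using n by (cases n) auto
  ultimately show "\<bar>poly (node_poly X n) t\<bar> \<le> 2 / 2 ^ n" by (simp add: field_simps)
qed

section \<open>Norms on the interval\<close>

lemma Lp_norm_inf_le:
  assumes "g \<in> borel_measurable (lebesgue_on {-1..1::real})" "\<And>t. t \<in> {-1..1} \<Longrightarrow> \<bar>g t\<bar> \<le> B"
  shows "Lp_norm \<infinity> g \<le> ennreal B"
proof -
  have [measurable]: "g \<in> borel_measurable (lebesgue_on {-1..1::real})" by fact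
  have "(\<lambda>t. ennreal \<bar>g t\<bar>) \<in> borel_measurable (lebesgue_on {-1..1::real})" by measurable
  then show ?thesis
    using assms(2) by (auto simp: Lp_norm_def intro!: esssup_I AE_I2 ennreal_leI)
qed

text \<open>A continuous function exceeds any number below \<open>\<bar>Q x\<bar>\<close> on a whole interval around \<open>x\<close>, which is
  not a null set, so that the essential supremum is at least \<open>\<bar>Q x\<bar>\<close>.\<close>

lemma Lp_norm_inf_ge:
  fixes Q g :: "real \<Rightarrow> real"
  assumes "\<And>t. t \<in> {-1..1} \<Longrightarrow> \<bar>Q t\<bar> \<le> \<bar>g t\<bar>" "continuous_on {-1..1} Q" "x \<in> {-1..1}"
  shows "ennreal \<bar>Q x\<bar> \<le> Lp_norm \<infinity> g"
proof (rule ccontr)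
  define z where "z = Lp_norm \<infinity> g"
  assume "\<not> ?thesis"
  then have less: "z < ennreal \<bar>Q x\<bar>" by (simp add: z_def)
  then obtain r where r: "z = ennreal r" "r \<ge> 0" by (cases z) (auto simp: top_unique)
  have rQ: "r < \<bar>Q x\<bar>" using less r by (simp add: ennreal_less_iff)
  obtain d where d: "d > 0" "\<And>t. t \<in> {-1..1} \<Longrightarrow> dist t x < d \<Longrightarrow> dist (Q t) (Q x) < \<bar>Q x\<bar> - r"
    using assms(2,3) rQ unfolding continuous_on_iff by (metis diff_gt_0_iff_gt)
  have big: "r < \<bar>g t\<bar>" if "t \<in> {-1..1}" "\<bar>t - x\<bar> < d" for t
    using d(2)[of t] assms(1)[of t] that by (auto simp: dist_real_def)
  define a b where "a = max (-1) (x - d / 2)" and "b = min 1 (x + d / 2)"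
  have ab: "a < b" "{a..b} \<subseteq> {-1..1}" "\<And>t. t \<in> {a..b} \<Longrightarrow> \<bar>t - x\<bar> < d"
    using assms(3) d(1) by (auto simp: a_def b_def)
  have "AE t in lebesgue_on {-1..1::real}. ennreal \<bar>g t\<bar> \<le> z"
    unfolding z_def Lp_norm_def using esssup_AE by auto
  then have "AE t in lebesgue_on {-1..1::real}. t \<notin> {a..b}"
  proof (rule AE_mp, intro AE_I2 impI)
    fix t assume t: "t \<in> space (lebesgue_on {-1..1::real})" "ennreal \<bar>g t\<bar> \<le> z"
    then show "t \<notin> {a..b}" using big[of t] ab(3)[of t] r by auto
  qed
  then have "emeasure (lebesgue_on {-1..1::real}) {a..b} = 0"
    using ab(2) by (subst (asm) AE_iff_measurable[where N = "{a..b}"]) (auto simp: sets_restrict_space_iff)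
  moreover have "emeasure (lebesgue_on {-1..1::real}) {a..b} = ennreal (b - a)"
    using ab by (simp add: emeasure_restrict_space)
  ultimately show False using ab(1) by simp
qed

lemma nn_integral_continuous_square:
  fixes Q :: "real \<Rightarrow> real"
  assumes "continuous_on {-1..1} Q"
  shows "(\<integral>\<^sup>+t. ennreal ((Q t)\<^sup>2) \<partial>lebesgue_on {-1..1::real}) = ennreal (integral {-1..1} (\<lambda>t. (Q t)\<^sup>2))"
proof -
  have int: "integrable (lebesgue_on {-1..1::real}) (\<lambda>t. (Q t)\<^sup>2)"
    by (intro continuous_imp_integrable_real continuous_intros assms)
  then have "(\<integral>\<^sup>+t. ennreal ((Q t)\<^sup>2) \<partial>lebesgue_on {-1..1::real})
      = ennreal (integral\<^sup>L (lebesgue_on {-1..1::real}) (\<lambda>t. (Q t)\<^sup>2))"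
    by (intro nn_integral_eq_integral) auto
  then show ?thesis using lebesgue_integral_eq_integral[OF int] by simp
qed

lemma Lp_norm_two:
  "Lp_norm 2 g = (let I = (\<integral>\<^sup>+t. ennreal ((g t)\<^sup>2) \<partial>lebesgue_on {-1..1::real})
    in if I = \<infinity> then \<infinity> else ennreal (sqrt (enn2real I)))"
  by (simp add: Lp_norm_def powr_half_sqrt Let_def)

lemma Lp_norm_two_le:
  fixes Q g :: "real \<Rightarrow> real"
  assumes "\<And>t. t \<in> {-1..1} \<Longrightarrow> \<bar>g t\<bar> \<le> \<bar>Q t\<bar>" "continuous_on {-1..1} Q"
    and "integral {-1..1} (\<lambda>t. (Q t)\<^sup>2) \<le> E\<^sup>2" "E \<ge> 0"
  shows "Lp_norm 2 g \<le> ennreal E"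
proof -
  define I where "I = (\<integral>\<^sup>+t. ennreal ((g t)\<^sup>2) \<partial>lebesgue_on {-1..1::real})"
  have "I \<le> (\<integral>\<^sup>+t. ennreal ((Q t)\<^sup>2) \<partial>lebesgue_on {-1..1::real})"
    unfolding I_def
  proof (rule nn_integral_mono)
    fix t assume "t \<in> space (lebesgue_on {-1..1::real})"
    then have "\<bar>g t\<bar> \<le> \<bar>Q t\<bar>" using assms(1) by simp
    then show "ennreal ((g t)\<^sup>2) \<le> ennreal ((Q t)\<^sup>2)"
      by (intro ennreal_leI) (simp add: abs_le_square_iff)
  qed
  also have "\<dots> = ennreal (integral {-1..1} (\<lambda>t. (Q t)\<^sup>2))"
    by (rule nn_integral_continuous_square[OF assms(2)])
  also have "\<dots> \<le> ennreal (E\<^sup>2)" using assms(3) by (rule ennreal_leI)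
  finally have I: "I \<le> ennreal (E\<^sup>2)" .
  then have fin: "I \<noteq> \<infinity>" by (auto simp: top_unique)
  have "enn2real I \<le> E\<^sup>2" using I by (simp add: enn2real_leI)
  then have "sqrt (enn2real I) \<le> E"
    using assms(4) by (simp add: real_le_lsqrt)
  then show ?thesis
    using fin by (simp add: Lp_norm_two I_def[symmetric] Let_def ennreal_leI)
qed

lemma Lp_norm_two_ge:
  fixes Q g :: "real \<Rightarrow> real"
  assumes "\<And>t. t \<in> {-1..1} \<Longrightarrow> \<bar>Q t\<bar> \<le> \<bar>g t\<bar>" "continuous_on {-1..1} Q"
  shows "ennreal (sqrt (integral {-1..1} (\<lambda>t. (Q t)\<^sup>2))) \<le> Lp_norm 2 g"
proof -
  define I where "I = (\<integral>\<^sup>+t. ennreal ((g t)\<^sup>2) \<partial>lebesgue_on {-1..1::real})"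
  have "ennreal (integral {-1..1} (\<lambda>t. (Q t)\<^sup>2)) = (\<integral>\<^sup>+t. ennreal ((Q t)\<^sup>2) \<partial>lebesgue_on {-1..1::real})"
    by (rule nn_integral_continuous_square[OF assms(2), symmetric])
  also have "\<dots> \<le> I"
    unfolding I_def
  proof (rule nn_integral_mono)
    fix t assume "t \<in> space (lebesgue_on {-1..1::real})"
    then have "\<bar>Q t\<bar> \<le> \<bar>g t\<bar>" using assms(1) by simp
    then show "ennreal ((Q t)\<^sup>2) \<le> ennreal ((g t)\<^sup>2)"
      by (intro ennreal_leI) (simp add: abs_le_square_iff)
  qed
  finally have I: "ennreal (integral {-1..1} (\<lambda>t. (Q t)\<^sup>2)) \<le> I" .
  show ?thesis
  proof (cases "I = \<infinity>")
    case False
    have "integral {-1..1} (\<lambda>t. (Q t)\<^sup>2) \<ge> 0"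
      by (rule integral_nonneg) (auto intro!: integrable_continuous_real continuous_intros assms)
    then have "integral {-1..1} (\<lambda>t. (Q t)\<^sup>2) \<le> enn2real I"
      using I False by (metis enn2real_ennreal enn2real_mono ennreal_enn2real_if infinity_ennreal_def top.not_eq_extremum)
    then have "sqrt (integral {-1..1} (\<lambda>t. (Q t)\<^sup>2)) \<le> sqrt (enn2real I)"
      by simp
    then show ?thesis
      using False by (simp add: Lp_norm_two I_def[symmetric] Let_def ennreal_leI)
  qed (simp add: Lp_norm_two I_def[symmetric])
qed


section \<open>Kernels with factorial growth\<close>

locale growth_kernel =
  fixes \<phi> :: "real \<Rightarrow> real" and \<alpha> :: "nat \<Rightarrow> real" and lam \<phi>min \<phi>max :: real
  assumes \<phi>_measurable [measurable]: "\<phi> \<in> borel_measurable (lebesgue_on {-1..1})"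
    and \<alpha>_pos: "\<And>k. \<alpha> k > 0"
    and \<alpha>_summable: "summable (\<lambda>k. inverse (\<alpha> k))"
    and \<phi>min_pos: "0 < \<phi>min"
    and \<phi>_bounds: "\<And>x. x \<in> {-1..1} \<Longrightarrow> \<phi>min \<le> \<bar>\<phi> x\<bar> \<and> \<bar>\<phi> x\<bar> \<le> \<phi>max"
    and lam_pos: "lam > 0"
    and growth: "\<And>m k. k \<le> m \<Longrightarrow> \<alpha> k / \<alpha> m \<le> lam ^ (m - k) * (fact k / fact m)"
begin

lemma \<phi>_nonzero: "x \<in> {-1..1} \<Longrightarrow> \<phi> x \<noteq> 0"
  using \<phi>_bounds[of x] \<phi>min_pos by auto

lemma \<phi>max_pos: "\<phi>max > 0"
  using \<phi>_bounds[of 0] \<phi>min_pos by auto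

lemma norm_eq: "HK_expansion \<phi> \<alpha> f c \<Longrightarrow> HK_norm \<phi> \<alpha> f = sqrt (\<Sum>k. \<alpha> k * (c k)\<^sup>2)"
  by (rule HK_norm_eq[OF \<alpha>_pos \<alpha>_summable \<phi>_nonzero])

lemma norm_pos:
  assumes "HK_expansion \<phi> \<alpha> f c" "x \<in> {-1..1}" "f x \<noteq> 0"
  shows "HK_norm \<phi> \<alpha> f > 0"
proof -
  have summ: "summable (\<lambda>k. \<alpha> k * (c k)\<^sup>2)" using assms(1) by (simp add: HK_expansion_def)
  have nonneg: "\<alpha> k * (c k)\<^sup>2 \<ge> 0" for k using \<alpha>_pos[of k] by simp
  have "\<exists>k. c k \<noteq> 0"
  proof (rule ccontr)
    assume "\<not> ?thesis"
    then have "f x = 0" using assms by (simp add: HK_expansion_def)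
    then show False using assms(3) by simp
  qed
  then obtain k where "c k \<noteq> 0" by blast
  then have "0 < \<alpha> k * (c k)\<^sup>2" using \<alpha>_pos[of k] by simp
  then have "0 < (\<Sum>k. \<alpha> k * (c k)\<^sup>2)" using suminf_pos2[OF summ nonneg] by blast
  then show ?thesis by (simp add: norm_eq[OF assms(1)])
qed

subsection \<open>Upper bounds\<close>

text \<open>Up to the factor \<open>\<phi>\<close>, the squared worst case of the series in front of the node polynomial. The growth condition
  compares \<open>1 / \<alpha> (n + j)\<close> with \<open>1 / \<alpha> n\<close>, and one of the two binomial coefficients cancels
  against the factorials.\<close>

lemma tail_sum_bound:
  assumes n: "m_L lam \<le> real n"
  shows "summable (\<lambda>k. inverse (\<alpha> k) * (real (k choose n))\<^sup>2)"
    and "(\<Sum>k. inverse (\<alpha> k) * (real (k choose n))\<^sup>2)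
      \<le> inverse (\<alpha> n) * (c_L lam * real n powr (-1/4) * exp (2 * sqrt (lam * real n)))"
proof -
  define g where "g k = inverse (\<alpha> k) * (real (k choose n))\<^sup>2" for k
  define L where "L j = lam ^ j / fact j * real ((n + j) choose j)" for j
  have L: "summable L" "suminf L \<le> c_L lam * real n powr (-1/4) * exp (2 * sqrt (lam * real n))"
    unfolding L_def using laguerre_sum_bound[OF lam_pos n] by auto
  have g0: "g k \<ge> 0" for k using \<alpha>_pos[of k] by (simp add: g_def)
  have gL: "g (j + n) \<le> inverse (\<alpha> n) * L j" for j
  proof -
    have pos: "\<alpha> n > 0" "\<alpha> (j + n) > 0" by (rule \<alpha>_pos)+
    have "\<alpha> n / \<alpha> (j + n) \<le> lam ^ j * (fact n / fact (j + n))"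
      using growth[of n "j + n"] by simp
    then have "inverse (\<alpha> (j + n)) \<le> inverse (\<alpha> n) * (lam ^ j * (fact n / fact (j + n)))"
      using pos by (simp add: field_simps)
    then have "g (j + n) \<le> inverse (\<alpha> n) * (lam ^ j * (fact n / fact (j + n))) * (real ((j + n) choose n))\<^sup>2"
      unfolding g_def by (intro mult_right_mono) auto
    also have "\<dots> = inverse (\<alpha> n) * L j"
    proof -
      define F where "F = (fact (n + j) :: real)"
      have F: "F > 0" by (simp add: F_def)
      have "real ((n + j) choose n) = F / (fact n * fact j)"
        and "real ((n + j) choose j) = F / (fact n * fact j)"
        by (simp_all add: binomial_fact F_def)
      then show ?thesis
        using F by (simp add: L_def power2_eq_square add.commute[of j] flip: F_def)
    qed
    finally show ?thesis .
  qed
  have "summable (\<lambda>j. g (j + n))"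
    by (rule summable_comparison_test'[OF summable_mult[OF L(1), of "inverse (\<alpha> n)"], of 0])
      (use gL g0 in auto)
  then show summ: "summable (\<lambda>k. inverse (\<alpha> k) * (real (k choose n))\<^sup>2)"
    unfolding g_def[symmetric] by (simp add: summable_iff_shift)
  have "suminf g = (\<Sum>j. g (j + n)) + (\<Sum>k<n. g k)"
    using summ unfolding g_def[symmetric] by (rule suminf_split_initial_segment)
  also have "(\<Sum>k<n. g k) = 0" by (intro sum.neutral) (auto simp: g_def)
  also have "(\<Sum>j. g (j + n)) + 0 \<le> (\<Sum>j. inverse (\<alpha> n) * L j)"
    using gL \<open>summable (\<lambda>j. g (j + n))\<close> L(1) by (simp add: suminf_le summable_mult)
  also have "\<dots> = inverse (\<alpha> n) * suminf L" using L(1) by (rule suminf_mult)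
  also have "\<dots> \<le> inverse (\<alpha> n) * (c_L lam * real n powr (-1/4) * exp (2 * sqrt (lam * real n)))"
    using L(2) \<alpha>_pos[of n] by (intro mult_left_mono) auto
  finally show "(\<Sum>k. inverse (\<alpha> k) * (real (k choose n))\<^sup>2)
      \<le> inverse (\<alpha> n) * (c_L lam * real n powr (-1/4) * exp (2 * sqrt (lam * real n)))"
    by (simp add: g_def)
qed

text \<open>The common factor of all upper bounds, to be multiplied by the size of the node polynomial.\<close>

definition error_bound :: "nat \<Rightarrow> real" where
  "error_bound n = c2_inf lam * \<phi>max * real n powr (-1/8) * exp (sqrt (lam * real n)) * \<alpha> n powr (-1/2)"

lemma error_bound_eq:
  "error_bound n = \<phi>max * sqrt (inverse (\<alpha> n) * (c_L lam * real n powr (-1/4) * exp (2 * sqrt (lam * real n))))"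
proof -
  have "\<alpha> n powr (-1/2) = sqrt (inverse (\<alpha> n))"
    using \<alpha>_pos[of n] by (simp add: powr_minus powr_half_sqrt real_sqrt_inverse)
  moreover have "real n powr (-1/8) = sqrt (real n powr (-1/4))"
    by (simp add: powr_half_sqrt[symmetric] powr_powr)
  moreover have "exp (sqrt (lam * real n)) = sqrt (exp (2 * sqrt (lam * real n)))"
    by (simp add: exp_double)
  ultimately show ?thesis by (simp add: error_bound_def c2_inf_def real_sqrt_mult)
qed

lemma error_bound_nonneg: "error_bound n \<ge> 0"
  using \<phi>max_pos c_L_pos[OF lam_pos] by (simp add: error_bound_def c2_inf_def)

text \<open>The weights \<open>\<phi> t / \<phi> (X k) * u k t\<close> undo the factor \<open>\<phi>\<close>, so that the power series is interpolated
  monomial by monomial. Cauchy-Schwarz is applied to partial sums, with \<open>\<alpha> k\<close> and its inverse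
  split between the two factors.\<close>

lemma interpolation_error:
  assumes n: "m_L lam \<le> real n" and X: "\<And>k. k \<in> {1..n} \<Longrightarrow> X k \<in> {-1..1}"
    and f: "HK_expansion \<phi> \<alpha> f c"
    and u: "\<And>k t. t ^ k - (\<Sum>i=1..n. X i ^ k * u i t) = divdiff X n k t * (\<Prod>i=1..n. t - X i)"
    and t: "t \<in> {-1..1}"
  shows "\<bar>f t - (\<Sum>k=1..n. f (X k) * (\<phi> t / \<phi> (X k) * u k t))\<bar>
    \<le> error_bound n * HK_norm \<phi> \<alpha> f * \<bar>poly (node_poly X n) t\<bar>"
proof -
  define Z where "Z = \<bar>poly (node_poly X n) t\<bar>"
  define A where "A = (\<Sum>k. \<alpha> k * (c k)\<^sup>2)"
  define B where "B = (\<Sum>k. inverse (\<alpha> k) * (real (k choose n))\<^sup>2)"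
  define e where "e k = t ^ k - (\<Sum>i=1..n. X i ^ k * u i t)" for k
  have summA: "summable (\<lambda>k. \<alpha> k * (c k)\<^sup>2)" using f by (simp add: HK_expansion_def)
  note summB = tail_sum_bound(1)[OF n]
  have e_le: "\<bar>e k\<bar> \<le> real (k choose n) * Z" for k
  proof -
    have "\<bar>divdiff X n k t\<bar> \<le> real (k choose n)"
      using X t by (intro abs_divdiff_le) (force simp: abs_le_iff)+
    then show ?thesis unfolding e_def u Z_def poly_node_poly abs_mult by (intro mult_right_mono) auto
  qed
  have sums_pow: "(\<lambda>k. c k * s ^ k) sums (f s / \<phi> s)" if "s \<in> {-1..1}" for s
    using HK_expansion_summable[OF \<alpha>_pos \<alpha>_summable f that] f \<phi>_nonzero[OF that] that
    by (auto simp: HK_expansion_def sums_iff)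
  have "(\<lambda>k. c k * t ^ k - (\<Sum>i=1..n. c k * X i ^ k * u i t)) sums (f t / \<phi> t - (\<Sum>i=1..n. f (X i) / \<phi> (X i) * u i t))"
    by (intro sums_diff sums_sum sums_mult2 sums_pow X t) auto
  moreover have "c k * t ^ k - (\<Sum>i=1..n. c k * X i ^ k * u i t) = c k * e k" for k
    by (simp add: e_def right_diff_distrib sum_distrib_left mult.assoc)
  moreover have "f t / \<phi> t - (\<Sum>i=1..n. f (X i) / \<phi> (X i) * u i t)
      = (f t - (\<Sum>k=1..n. f (X k) * (\<phi> t / \<phi> (X k) * u k t))) / \<phi> t"
    using \<phi>_nonzero[OF t] by (simp add: diff_divide_distrib sum_divide_distrib)
  ultimately have sums: "(\<lambda>k. c k * e k) sums ((f t - (\<Sum>k=1..n. f (X k) * (\<phi> t / \<phi> (X k) * u k t))) / \<phi> t)"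
    (is "_ sums ?E") by simp
  have partial: "\<bar>\<Sum>k<N. c k * e k\<bar> \<le> sqrt A * sqrt B * Z" for N
  proof -
    have "\<bar>\<Sum>k<N. c k * e k\<bar> \<le> (\<Sum>k<N. \<bar>c k * e k\<bar>)" by (rule sum_abs)
    also have "\<dots> \<le> (\<Sum>k<N. (sqrt (\<alpha> k) * \<bar>c k\<bar>) * (sqrt (inverse (\<alpha> k)) * real (k choose n)) * Z)"
    proof (rule sum_mono)
      fix k
      have one: "sqrt (\<alpha> k) * sqrt (inverse (\<alpha> k)) = 1"
        using \<alpha>_pos[of k] by (simp flip: real_sqrt_mult)
      have "\<bar>c k * e k\<bar> \<le> \<bar>c k\<bar> * (real (k choose n) * Z)"
        using e_le[of k] by (simp add: abs_mult mult_left_mono)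
      also have "\<dots> = (sqrt (\<alpha> k) * sqrt (inverse (\<alpha> k))) * (\<bar>c k\<bar> * (real (k choose n) * Z))"
        unfolding one by simp
      also have "\<dots> = (sqrt (\<alpha> k) * \<bar>c k\<bar>) * (sqrt (inverse (\<alpha> k)) * real (k choose n)) * Z"
        by (simp only: mult_ac)
      finally show "\<bar>c k * e k\<bar> \<le> (sqrt (\<alpha> k) * \<bar>c k\<bar>) * (sqrt (inverse (\<alpha> k)) * real (k choose n)) * Z" .
    qed
    also have "\<dots> = (\<Sum>k<N. (sqrt (\<alpha> k) * \<bar>c k\<bar>) * (sqrt (inverse (\<alpha> k)) * real (k choose n))) * Z"
      by (simp add: sum_distrib_right)
    also have "\<dots> \<le> (sqrt A * sqrt B) * Z"
    proof (rule mult_right_mono)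
      have "(\<Sum>k<N. (sqrt (\<alpha> k) * \<bar>c k\<bar>) * (sqrt (inverse (\<alpha> k)) * real (k choose n)))\<^sup>2
          \<le> (\<Sum>k<N. (sqrt (\<alpha> k) * \<bar>c k\<bar>)\<^sup>2) * (\<Sum>k<N. (sqrt (inverse (\<alpha> k)) * real (k choose n))\<^sup>2)"
        by (rule Cauchy_Schwarz_ineq_sum)
      also have "\<dots> = (\<Sum>k<N. \<alpha> k * (c k)\<^sup>2) * (\<Sum>k<N. inverse (\<alpha> k) * (real (k choose n))\<^sup>2)"
        using \<alpha>_pos by (simp add: power_mult_distrib less_imp_le)
      also have "\<dots> \<le> A * B"
        unfolding A_def B_def using \<alpha>_pos
        by (intro mult_mono sum_le_suminf summA summB sum_nonneg suminf_nonneg)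
          (auto simp: less_imp_le[OF \<alpha>_pos])
      finally have "(\<Sum>k<N. (sqrt (\<alpha> k) * \<bar>c k\<bar>) * (sqrt (inverse (\<alpha> k)) * real (k choose n))) \<le> sqrt (A * B)"
        by (rule real_le_rsqrt)
      then show "(\<Sum>k<N. (sqrt (\<alpha> k) * \<bar>c k\<bar>) * (sqrt (inverse (\<alpha> k)) * real (k choose n))) \<le> sqrt A * sqrt B"
        by (simp add: real_sqrt_mult)
    qed (simp add: Z_def)
    finally show ?thesis by simp
  qed
  have "(\<lambda>N. \<bar>\<Sum>k<N. c k * e k\<bar>) \<longlonglongrightarrow> \<bar>?E\<bar>"
    using sums unfolding sums_def by (rule tendsto_rabs)
  then have E: "\<bar>?E\<bar> \<le> sqrt A * sqrt B * Z"
    by (rule LIMSEQ_le_const2) (use partial in auto)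
  have "\<bar>f t - (\<Sum>k=1..n. f (X k) * (\<phi> t / \<phi> (X k) * u k t))\<bar> = \<bar>\<phi> t\<bar> * \<bar>?E\<bar>"
    using \<phi>_nonzero[OF t] by (simp add: abs_divide)
  also have "\<dots> \<le> \<phi>max * (sqrt A * sqrt B * Z)"
    using \<phi>_bounds[OF t] \<phi>max_pos E by (intro mult_mono) auto
  also have "\<dots> = (\<phi>max * sqrt B) * sqrt A * Z" by simp
  also have "\<dots> \<le> error_bound n * sqrt A * Z"
    unfolding error_bound_eq B_def using tail_sum_bound(2)[OF n] \<phi>max_pos
    by (intro mult_right_mono mult_left_mono real_sqrt_le_mono) (auto simp: A_def Z_def suminf_nonneg summA \<alpha>_pos less_imp_le)
  finally show ?thesis by (simp add: norm_eq[OF f] A_def Z_def)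
qed

lemma HK_measurable:
  assumes "HK_expansion \<phi> \<alpha> f c"
  shows "f \<in> borel_measurable (lebesgue_on {-1..1})"
proof -
  have [measurable]: "(\<lambda>x. x ^ k :: real) \<in> borel_measurable (lebesgue_on {-1..1})" for k
    by (intro continuous_imp_measurable_on_sets_lebesgue continuous_intros) auto
  have "(\<lambda>x. \<phi> x * (\<Sum>k. c k * x ^ k)) \<in> borel_measurable (lebesgue_on {-1..1})"
    by measurable
  then show ?thesis
    by (rule measurable_cong[THEN iffD1, rotated]) (use assms in \<open>auto simp: HK_expansion_def\<close>)
qed

lemma ratio_le:
  assumes "f \<in> HK_nonzero \<phi> \<alpha>" "A \<le> ennreal (C * HK_norm \<phi> \<alpha> f)" "C \<ge> 0"
  shows "A / ennreal (HK_norm \<phi> \<alpha> f) \<le> ennreal C"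
proof -
  have pos: "HK_norm \<phi> \<alpha> f > 0"
    using assms(1) norm_pos by (auto simp: HK_nonzero_def HK_def)
  have "A / ennreal (HK_norm \<phi> \<alpha> f) \<le> ennreal (C * HK_norm \<phi> \<alpha> f) / ennreal (HK_norm \<phi> \<alpha> f)"
    by (rule divide_right_mono_ennreal[OF assms(2)])
  also have "\<dots> = ennreal C" using pos assms(3) by (simp add: divide_ennreal)
  finally show ?thesis .
qed

lemma emin_at_le:
  assumes n: "m_L lam \<le> real n" and X: "\<And>k. k \<in> {1..n} \<Longrightarrow> X k \<in> {-1..1}"
    and inj: "inj_on X {1..n}" and x: "x \<in> {-1..1}"
  shows "emin_at \<phi> \<alpha> n X x \<le> ennreal (error_bound n * \<bar>poly (node_poly X n) x\<bar>)"
proof -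
  obtain u :: "nat \<Rightarrow> real \<Rightarrow> real"
    where u: "\<And>k t. t ^ k - (\<Sum>i=1..n. X i ^ k * u i t) = divdiff X n k t * (\<Prod>i=1..n. t - X i)"
    using ex_interpolation_weights[OF inj] by blast
  show ?thesis
    unfolding emin_at_def
  proof (rule INF_lower2[where i = "\<lambda>k. \<phi> x / \<phi> (X k) * u k x"])
    show "(SUP f\<in>HK_nonzero \<phi> \<alpha>. ennreal \<bar>f x - (\<Sum>k=1..n. f (X k) * (\<phi> x / \<phi> (X k) * u k x))\<bar> / ennreal (HK_norm \<phi> \<alpha> f))
        \<le> ennreal (error_bound n * \<bar>poly (node_poly X n) x\<bar>)"
    proof (rule SUP_least)
      fix f assume f: "f \<in> HK_nonzero \<phi> \<alpha>"
      then obtain c where "HK_expansion \<phi> \<alpha> f c" by (auto simp: HK_nonzero_def HK_def)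
      from interpolation_error[OF n X this u x]
      show "ennreal \<bar>f x - (\<Sum>k=1..n. f (X k) * (\<phi> x / \<phi> (X k) * u k x))\<bar> / ennreal (HK_norm \<phi> \<alpha> f)
          \<le> ennreal (error_bound n * \<bar>poly (node_poly X n) x\<bar>)"
        by (intro ratio_le[OF f] ennreal_leI mult_nonneg_nonneg error_bound_nonneg) (auto simp: mult_ac)
    qed
  qed simp
qed

text \<open>The weight functions lie in \<open>L\<^sup>p\<close> because they are measurable and dominated by continuous functions.
  The number \<open>E\<close> bounds the \<open>L\<^sup>p\<close> norm of the node polynomial.\<close>

lemma emin_points_le:
  assumes n: "m_L lam \<le> real n" and X: "\<And>k. k \<in> {1..n} \<Longrightarrow> X k \<in> {-1..1}"
    and inj: "inj_on X {1..n}" and p: "p \<in> {2, \<infinity>}" and E: "E \<ge> 0"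
    and E_inf: "\<And>t. p = \<infinity> \<Longrightarrow> t \<in> {-1..1} \<Longrightarrow> \<bar>poly (node_poly X n) t\<bar> \<le> E"
    and E_two: "p = 2 \<Longrightarrow> integral {-1..1} (\<lambda>t. (poly (node_poly X n) t)\<^sup>2) \<le> E\<^sup>2"
  shows "emin_points \<phi> \<alpha> p n X \<le> ennreal (error_bound n * E)"
proof -
  obtain u :: "nat \<Rightarrow> real \<Rightarrow> real"
    where cont: "\<And>i. continuous_on UNIV (u i)"
      and u: "\<And>k t. t ^ k - (\<Sum>i=1..n. X i ^ k * u i t) = divdiff X n k t * (\<Prod>i=1..n. t - X i)"
    using ex_interpolation_weights[OF inj] by blast
  have [measurable]: "u k \<in> borel_measurable (lebesgue_on {-1..1})" for k
    by (intro continuous_imp_measurable_on_sets_lebesgue continuous_on_subset[OF cont]) auto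
  define \<psi> where "\<psi> k t = \<phi> t / \<phi> (X k) * u k t" for k t
  have \<psi>_meas [measurable]: "\<psi> k \<in> borel_measurable (lebesgue_on {-1..1})" for k
    unfolding \<psi>_def by measurable
  have "\<psi> k \<in> Lp p" if k: "k \<in> {1..n}" for k
  proof -
    have cont2: "continuous_on {-1..1} (\<lambda>t. \<phi>max / \<bar>\<phi> (X k)\<bar> * u k t)"
      by (intro continuous_intros continuous_on_subset[OF cont]) auto
    have \<psi>_le: "\<bar>\<psi> k t\<bar> \<le> \<bar>\<phi>max / \<bar>\<phi> (X k)\<bar> * u k t\<bar>" if "t \<in> {-1..1}" for t
      using \<phi>_bounds[OF that] \<phi>_nonzero[OF X[OF k]] \<phi>max_pos
      by (auto simp: \<psi>_def abs_mult intro!: mult_right_mono divide_right_mono)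
    have "compact ((\<lambda>t. \<phi>max / \<bar>\<phi> (X k)\<bar> * u k t) ` {-1..1})"
      by (intro compact_continuous_image cont2) auto
    then obtain C where C: "\<And>t. t \<in> {-1..1} \<Longrightarrow> \<bar>\<phi>max / \<bar>\<phi> (X k)\<bar> * u k t\<bar> \<le> C"
      using compact_imp_bounded by (force simp: bounded_real)
    have "Lp_norm p (\<psi> k) < \<infinity>"
    proof (cases "p = \<infinity>")
      case True
      have "Lp_norm \<infinity> (\<psi> k) \<le> ennreal C"
        by (rule Lp_norm_inf_le) (use \<psi>_le C in \<open>auto intro: order_trans\<close>)
      then show ?thesis using True by (simp add: le_less_trans)
    next
      case False
      let ?I = "integral {-1..1} (\<lambda>t. (\<phi>max / \<bar>\<phi> (X k)\<bar> * u k t)\<^sup>2)"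
      have I: "?I \<ge> 0"
        by (intro integral_nonneg integrable_continuous_real continuous_on_power cont2) simp
      have "Lp_norm 2 (\<psi> k) \<le> ennreal (sqrt ?I)"
        by (rule Lp_norm_two_le[OF \<psi>_le cont2]) (use I in auto)
      then show ?thesis using False p by (simp add: le_less_trans)
    qed
    then show ?thesis by (simp add: Lp_def)
  qed
  then show ?thesis
    unfolding emin_points_def
  proof (intro INF_lower2[where i = \<psi>])
    show "(SUP f\<in>HK_nonzero \<phi> \<alpha>. Lp_norm p (\<lambda>t. f t - (\<Sum>k=1..n. f (X k) * \<psi> k t)) / ennreal (HK_norm \<phi> \<alpha> f))
        \<le> ennreal (error_bound n * E)"
    proof (rule SUP_least)
      fix f assume f: "f \<in> HK_nonzero \<phi> \<alpha>"
      then obtain c where c: "HK_expansion \<phi> \<alpha> f c" by (auto simp: HK_nonzero_def HK_def)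
      define g where "g t = f t - (\<Sum>k=1..n. f (X k) * \<psi> k t)" for t
      define h where "h = error_bound n * HK_norm \<phi> \<alpha> f"
      have [measurable]: "f \<in> borel_measurable (lebesgue_on {-1..1})" by (rule HK_measurable[OF c])
      have g_meas: "g \<in> borel_measurable (lebesgue_on {-1..1})" unfolding g_def by measurable
      have "HK_norm \<phi> \<alpha> f \<ge> 0"
        using c \<alpha>_pos by (auto simp: norm_eq[OF c] HK_expansion_def less_imp_le intro!: suminf_nonneg)
      then have h: "h \<ge> 0" by (simp add: h_def error_bound_nonneg)
      have g_le: "\<bar>g t\<bar> \<le> h * \<bar>poly (node_poly X n) t\<bar>" if "t \<in> {-1..1}" for t
        using interpolation_error[OF n X c u that] by (simp add: g_def \<psi>_def h_def)
      have "Lp_norm p g \<le> ennreal (h * E)"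
      proof (cases "p = \<infinity>")
        case True
        have "\<bar>g t\<bar> \<le> h * E" if "t \<in> {-1..1}" for t
          using g_le[OF that] mult_left_mono[OF E_inf[OF True that] h] by linarith
        then show ?thesis using Lp_norm_inf_le[OF g_meas] True by simp
      next
        case False
        then have p2: "p = 2" using p by simp
        have "Lp_norm 2 g \<le> ennreal (h * E)"
        proof (rule Lp_norm_two_le)
          show "continuous_on {-1..1} (\<lambda>t. h * poly (node_poly X n) t)" by (intro continuous_intros)
          show "\<bar>g t\<bar> \<le> \<bar>h * poly (node_poly X n) t\<bar>" if "t \<in> {-1..1}" for t
            using g_le[OF that] h by (simp add: abs_mult)
          show "integral {-1..1} (\<lambda>t. (h * poly (node_poly X n) t)\<^sup>2) \<le> (h * E)\<^sup>2"
            using E_two[OF p2] by (simp add: power_mult_distrib mult_left_mono)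
        qed (use h E in auto)
        then show ?thesis using p2 by simp
      qed
      then show "Lp_norm p (\<lambda>t. f t - (\<Sum>k=1..n. f (X k) * \<psi> k t)) / ennreal (HK_norm \<phi> \<alpha> f) \<le> ennreal (error_bound n * E)"
        using E error_bound_nonneg[of n] unfolding g_def[symmetric]
        by (intro ratio_le[OF f]) (auto simp: h_def mult_ac)
    qed
  qed simp
qed

subsection \<open>Lower bounds\<close>

text \<open>An element of \<open>H(K)\<close> that no algorithm using its values at the nodes can tell from zero.\<close>

definition fooling :: "(nat \<Rightarrow> real) \<Rightarrow> nat \<Rightarrow> real \<Rightarrow> real" where
  "fooling X n t = \<phi> t * poly (node_poly X n) t"

lemma fooling_expansion: "HK_expansion \<phi> \<alpha> (fooling X n) (coeff (node_poly X n))"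
proof -
  let ?P = "node_poly X n"
  have fin: "summable (\<lambda>k. \<alpha> k * (coeff ?P k)\<^sup>2)"
    by (rule summable_finite[of "{..degree ?P}"]) (auto simp: coeff_eq_0)
  have "(\<Sum>k. coeff ?P k * x ^ k) = (\<Sum>k\<le>degree ?P. coeff ?P k * x ^ k)" for x
    by (rule suminf_finite) (auto simp: coeff_eq_0)
  then show ?thesis using fin by (simp add: HK_expansion_def fooling_def poly_altdef)
qed

lemma fooling_zero: "k \<in> {1..n} \<Longrightarrow> fooling X n (X k) = 0"
  by (auto simp: fooling_def node_poly_eq_0_iff)

lemma fooling_nonzero: "fooling X n \<in> HK_nonzero \<phi> \<alpha>"
proof -
  have "infinite ({-1..1::real} - X ` {1..n})"
    by (intro Diff_infinite_finite) (auto simp: infinite_Icc)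
  then obtain x where "x \<in> {-1..1} - X ` {1..n}" by (metis equals0I finite.emptyI)
  then have "x \<in> {-1..1}" "fooling X n x \<noteq> 0"
    by (auto simp: fooling_def node_poly_eq_0_iff \<phi>_nonzero)
  then show ?thesis
    using fooling_expansion unfolding HK_nonzero_def HK_def by blast
qed

lemma fooling_norm_pos: "HK_norm \<phi> \<alpha> (fooling X n) > 0"
proof -
  obtain x where "x \<in> {-1..1}" "fooling X n x \<noteq> 0"
    using fooling_nonzero[of X n] by (auto simp: HK_nonzero_def)
  then show ?thesis by (rule norm_pos[OF fooling_expansion])
qed

text \<open>The growth condition replaces the weights \<open>\<alpha> k\<close> by factorial ones.\<close>

lemma fooling_norm_le:
  assumes "(\<Sum>k\<le>n. lam ^ (n - k) * (fact k / fact n) * (coeff (node_poly X n) k)\<^sup>2) \<le> W\<^sup>2" "W \<ge> 0"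
  shows "HK_norm \<phi> \<alpha> (fooling X n) \<le> sqrt (\<alpha> n) * W"
proof -
  let ?c = "coeff (node_poly X n)"
  have "(\<Sum>k. \<alpha> k * (?c k)\<^sup>2) = (\<Sum>k\<le>n. \<alpha> k * (?c k)\<^sup>2)"
    by (rule suminf_finite) (auto simp: coeff_eq_0 monic_node_poly)
  also have "\<dots> \<le> (\<Sum>k\<le>n. \<alpha> n * (lam ^ (n - k) * (fact k / fact n) * (?c k)\<^sup>2))"
  proof (rule sum_mono)
    fix k assume "k \<in> {..n}"
    then have "\<alpha> k \<le> \<alpha> n * (lam ^ (n - k) * (fact k / fact n))"
      using growth[of k n] \<alpha>_pos[of n] by (simp add: divide_le_eq mult.commute)
    then have "\<alpha> k * (?c k)\<^sup>2 \<le> \<alpha> n * (lam ^ (n - k) * (fact k / fact n)) * (?c k)\<^sup>2"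
      by (rule mult_right_mono) simp
    then show "\<alpha> k * (?c k)\<^sup>2 \<le> \<alpha> n * (lam ^ (n - k) * (fact k / fact n) * (?c k)\<^sup>2)"
      by (simp only: mult.assoc)
  qed
  also have "\<dots> = \<alpha> n * (\<Sum>k\<le>n. lam ^ (n - k) * (fact k / fact n) * (?c k)\<^sup>2)"
    by (simp only: sum_distrib_left)
  also have "\<dots> \<le> \<alpha> n * W\<^sup>2"
    using assms(1) \<alpha>_pos[of n] by (intro mult_left_mono) auto
  finally have "sqrt (\<Sum>k. \<alpha> k * (?c k)\<^sup>2) \<le> sqrt (\<alpha> n * W\<^sup>2)" by (rule real_sqrt_le_mono)
  also have "\<dots> = sqrt (\<alpha> n) * W" using assms(2) by (simp add: real_sqrt_mult)
  finally show ?thesis by (simp add: norm_eq[OF fooling_expansion])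
qed

lemma ennreal_ratio_ge:
  assumes "ennreal (C * N) \<le> A" "N > 0" "C \<ge> 0"
  shows "ennreal C \<le> A / ennreal N"
proof -
  have "ennreal C = ennreal (C * N) / ennreal N" using assms by (simp add: divide_ennreal)
  also have "\<dots> \<le> A / ennreal N" by (rule divide_right_mono_ennreal[OF assms(1)])
  finally show ?thesis .
qed

lemma emin_at_ge:
  assumes "C * HK_norm \<phi> \<alpha> (fooling X n) \<le> \<bar>fooling X n x\<bar>" "C \<ge> 0"
  shows "ennreal C \<le> emin_at \<phi> \<alpha> n X x"
  unfolding emin_at_def
proof (rule INF_greatest)
  fix u :: "nat \<Rightarrow> real"
  have "ennreal C \<le> ennreal \<bar>fooling X n x - (\<Sum>k=1..n. fooling X n (X k) * u k)\<bar> / ennreal (HK_norm \<phi> \<alpha> (fooling X n))"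
    using assms by (intro ennreal_ratio_ge fooling_norm_pos) (auto simp: fooling_zero intro!: ennreal_leI)
  also have "\<dots> \<le> (SUP f\<in>HK_nonzero \<phi> \<alpha>. ennreal \<bar>f x - (\<Sum>k=1..n. f (X k) * u k)\<bar> / ennreal (HK_norm \<phi> \<alpha> f))"
    by (rule SUP_upper[OF fooling_nonzero])
  finally show "ennreal C \<le> \<dots>" .
qed

lemma emin_points_ge:
  assumes "ennreal (C * HK_norm \<phi> \<alpha> (fooling X n)) \<le> Lp_norm p (fooling X n)" "C \<ge> 0"
  shows "ennreal C \<le> emin_points \<phi> \<alpha> p n X"
  unfolding emin_points_def
proof (rule INF_greatest)
  fix \<psi> :: "nat \<Rightarrow> real \<Rightarrow> real"
  have "ennreal C \<le> Lp_norm p (\<lambda>t. fooling X n t - (\<Sum>k=1..n. fooling X n (X k) * \<psi> k t)) / ennreal (HK_norm \<phi> \<alpha> (fooling X n))"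
    using assms by (intro ennreal_ratio_ge fooling_norm_pos) (auto simp: fooling_zero)
  also have "\<dots> \<le> (SUP f\<in>HK_nonzero \<phi> \<alpha>. Lp_norm p (\<lambda>t. f t - (\<Sum>k=1..n. f (X k) * \<psi> k t)) / ennreal (HK_norm \<phi> \<alpha> f))"
    by (rule SUP_upper[OF fooling_nonzero])
  finally show "ennreal C \<le> \<dots>" .
qed


lemma fooling_abs_ge:
  assumes "t \<in> {-1..1}"
  shows "\<bar>\<phi>min * poly (node_poly X n) t\<bar> \<le> \<bar>fooling X n t\<bar>"
  using \<phi>_bounds[OF assms] \<phi>min_pos by (simp add: fooling_def abs_mult mult_right_mono)

lemma fooling_norm_le_sup_norm:
  assumes n: "n \<ge> 1" and M: "\<And>x. x \<in> {-1..1} \<Longrightarrow> \<bar>poly (node_poly X n) x\<bar> \<le> M"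
  shows "c1_inf lam \<phi>min * 2 powr (- real n) * \<alpha> n powr (-1/2) * HK_norm \<phi> \<alpha> (fooling X n) \<le> \<phi>min * M"
proof -
  define W where "W = 2 ^ n * (sqrt ((1 + lam) / 2) * exp (lam\<^sup>2 / 32)) * M"
  have "M \<ge> 0" using M[of 0] by auto
  have e: "(exp (lam\<^sup>2 / 32))\<^sup>2 = exp (lam\<^sup>2 / 16)" by (simp flip: exp_double)
  have "W\<^sup>2 = 4 ^ n / 2 * (1 + lam) * exp (lam\<^sup>2 / 16) * M\<^sup>2"
    using lam_pos by (simp add: W_def power_mult_distrib e square_two_power)
  then have le: "HK_norm \<phi> \<alpha> (fooling X n) \<le> sqrt (\<alpha> n) * W"
    using weighted_coeff_le_sup_norm[OF lam_pos n _ M] \<open>M \<ge> 0\<close> lam_pos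
    by (intro fooling_norm_le) (auto simp: monic_node_poly W_def)
  have c: "c1_inf lam \<phi>min * 2 powr (- real n) * \<alpha> n powr (-1/2)
      = \<phi>min / (2 ^ n * (sqrt ((1 + lam) / 2) * exp (lam\<^sup>2 / 32)) * sqrt (\<alpha> n))"
    using \<alpha>_pos[of n] lam_pos
    by (simp add: c1_inf_def powr_minus powr_realpow powr_half_sqrt exp_minus real_sqrt_divide field_simps)
  have "c1_inf lam \<phi>min * 2 powr (- real n) * \<alpha> n powr (-1/2) * HK_norm \<phi> \<alpha> (fooling X n)
      \<le> \<phi>min / (2 ^ n * (sqrt ((1 + lam) / 2) * exp (lam\<^sup>2 / 32)) * sqrt (\<alpha> n)) * (sqrt (\<alpha> n) * W)"
    unfolding c using le \<phi>min_pos lam_pos \<alpha>_pos[of n] by (intro mult_left_mono) auto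
  also have "\<dots> = \<phi>min * M"
  proof -
    define D where "D = 2 ^ n * (sqrt ((1 + lam) / 2) * exp (lam\<^sup>2 / 32))"
    have "D > 0" using lam_pos by (simp add: D_def)
    then show ?thesis using \<alpha>_pos[of n] by (simp add: W_def flip: D_def)
  qed
  finally show ?thesis .
qed

text \<open>The estimate of the coefficients gives the constant \<open>1 / sqrt (8 / pi)\<close>, which is larger than
  the factor in front of the exponential in \<open>c1_two\<close>.\<close>

lemma fooling_norm_le_L2_norm:
  "c1_two lam \<phi>min * 2 powr (- real n) * \<alpha> n powr (-1/2) * HK_norm \<phi> \<alpha> (fooling X n)
    \<le> \<phi>min * sqrt (integral {-1..1} (\<lambda>x. (poly (node_poly X n) x)\<^sup>2))"
proof -
  let ?Q = "integral {-1..1} (\<lambda>x. (poly (node_poly X n) x)\<^sup>2)"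
  have Q: "?Q \<ge> 0" by (intro integral_nonneg integrable_continuous_real continuous_intros) auto
  define D where "D = 2 ^ n * (sqrt (8 / pi) * exp (lam\<^sup>2 / 32))"
  have D: "D > 0" by (simp add: D_def)
  define W where "W = D * sqrt ?Q"
  have e: "(exp (lam\<^sup>2 / 32))\<^sup>2 = exp (lam\<^sup>2 / 16)" by (simp flip: exp_double)
  have "W\<^sup>2 = 4 ^ n * (8 / pi) * exp (lam\<^sup>2 / 16) * ?Q"
    using Q by (simp add: W_def D_def power_mult_distrib e square_two_power)
  then have le: "HK_norm \<phi> \<alpha> (fooling X n) \<le> sqrt (\<alpha> n) * W"
    using weighted_coeff_le_L2_norm[OF lam_pos, of "node_poly X n" n] D Q
    by (intro fooling_norm_le) (auto simp: monic_node_poly W_def)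
  have const: "2 * sqrt (2 * pi) / (3 * exp 3 * sqrt (3 * (4 + lam))) \<le> 1 / sqrt (8 / pi)"
  proof -
    \<comment> \<open>From \<open>exp 3 \<ge> 1 + 3\<close>; a crude bound suffices here.\<close>
    have "4 * 1 \<le> exp 3 * sqrt (3 * (4 + lam))"
      using lam_pos exp_ge_add_one_self[of 3] by (intro mult_mono real_le_rsqrt) auto
    then have "2 * sqrt (2 * pi) / (3 * exp 3 * sqrt (3 * (4 + lam))) \<le> 2 * sqrt (2 * pi) / (3 * 4)"
      by (intro divide_left_mono) (use lam_pos in auto)
    also have "\<dots> \<le> sqrt (2 * pi) / 4" by simp
    also have "sqrt (8 / pi) * sqrt (2 * pi) = sqrt (4\<^sup>2)" unfolding real_sqrt_mult[symmetric] by simp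
    then have "sqrt (2 * pi) / 4 = 1 / sqrt (8 / pi)" by (simp add: field_simps)
    finally show ?thesis .
  qed
  have "c1_two lam \<phi>min * 2 powr (- real n) * \<alpha> n powr (-1/2)
      = 2 * sqrt (2 * pi) / (3 * exp 3 * sqrt (3 * (4 + lam)))
        * (exp (- (lam\<^sup>2 / 32)) * \<phi>min * 2 powr (- real n) * \<alpha> n powr (-1/2))"
    by (simp add: c1_two_def)
  also have "\<dots> \<le> 1 / sqrt (8 / pi) * (exp (- (lam\<^sup>2 / 32)) * \<phi>min * 2 powr (- real n) * \<alpha> n powr (-1/2))"
    using \<phi>min_pos by (intro mult_right_mono const) auto
  also have "\<dots> = \<phi>min / (D * sqrt (\<alpha> n))"
  proof -
    have "exp (- (lam\<^sup>2 / 32)) = 1 / exp (lam\<^sup>2 / 32)" "2 powr (- real n) = 1 / 2 ^ n"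
      "\<alpha> n powr (-1/2) = 1 / sqrt (\<alpha> n)"
      using \<alpha>_pos[of n] by (simp_all add: exp_minus inverse_eq_divide powr_minus_divide powr_realpow powr_half_sqrt)
    then show ?thesis unfolding D_def by simp
  qed
  finally have "c1_two lam \<phi>min * 2 powr (- real n) * \<alpha> n powr (-1/2) \<le> \<phi>min / (D * sqrt (\<alpha> n))" .
  then have "c1_two lam \<phi>min * 2 powr (- real n) * \<alpha> n powr (-1/2) * HK_norm \<phi> \<alpha> (fooling X n)
      \<le> \<phi>min / (D * sqrt (\<alpha> n)) * (sqrt (\<alpha> n) * W)"
    using le \<phi>min_pos D \<alpha>_pos[of n] fooling_norm_pos[of X n] by (intro mult_mono) auto
  also have "\<dots> = \<phi>min * sqrt ?Q" using D \<alpha>_pos[of n] by (simp add: W_def)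
  finally show ?thesis .
qed

lemma emin_points_lower:
  assumes n: "n \<ge> 1" and p: "p \<in> {2, \<infinity>}"
  shows "ennreal (c1 p lam \<phi>min * 2 powr (- real n) * \<alpha> n powr (-1/2)) \<le> emin_points \<phi> \<alpha> p n X"
proof (rule emin_points_ge)
  let ?P = "poly (node_poly X n)"
  have cont: "continuous_on {-1..1} (\<lambda>t. \<phi>min * ?P t)" by (intro continuous_intros)
  show "ennreal (c1 p lam \<phi>min * 2 powr (- real n) * \<alpha> n powr (-1/2) * HK_norm \<phi> \<alpha> (fooling X n))
      \<le> Lp_norm p (fooling X n)"
  proof (cases "p = \<infinity>")
    case True
    \<comment> \<open>The maximum \<open>x\<close> of the node polynomial is a point where the supremum norm is attained.\<close>
    have "continuous_on {-1..1} (\<lambda>t. \<bar>?P t\<bar>)" by (intro continuous_intros)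
    then obtain x where x: "x \<in> {-1..1}" "\<And>t. t \<in> {-1..1} \<Longrightarrow> \<bar>?P t\<bar> \<le> \<bar>?P x\<bar>"
      using continuous_attains_sup[of "{-1..1}" "\<lambda>t. \<bar>?P t\<bar>"] by auto
    have "ennreal (c1_inf lam \<phi>min * 2 powr (- real n) * \<alpha> n powr (-1/2) * HK_norm \<phi> \<alpha> (fooling X n))
        \<le> ennreal \<bar>\<phi>min * ?P x\<bar>"
      using fooling_norm_le_sup_norm[OF n x(2)] \<phi>min_pos by (intro ennreal_leI) (simp add: abs_mult)
    also have "\<dots> \<le> Lp_norm \<infinity> (fooling X n)"
      by (rule Lp_norm_inf_ge[OF fooling_abs_ge cont x(1)])
    finally show ?thesis using True by (simp add: c1_def)
  next
    case False
    have "c1_two lam \<phi>min * 2 powr (- real n) * \<alpha> n powr (-1/2) * HK_norm \<phi> \<alpha> (fooling X n)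
        \<le> sqrt (integral {-1..1} (\<lambda>t. (\<phi>min * ?P t)\<^sup>2))"
      using fooling_norm_le_L2_norm[of n X] \<phi>min_pos
      by (simp add: power_mult_distrib real_sqrt_mult)
    then have "ennreal (c1_two lam \<phi>min * 2 powr (- real n) * \<alpha> n powr (-1/2) * HK_norm \<phi> \<alpha> (fooling X n))
        \<le> ennreal (sqrt (integral {-1..1} (\<lambda>t. (\<phi>min * ?P t)\<^sup>2)))"
      by (rule ennreal_leI)
    also have "\<dots> \<le> Lp_norm 2 (fooling X n)"
      by (rule Lp_norm_two_ge[OF fooling_abs_ge cont])
    finally show ?thesis using False p by (simp add: c1_def)
  qed
  show "0 \<le> c1 p lam \<phi>min * 2 powr (- real n) * \<alpha> n powr (-1/2)"
    using \<phi>min_pos lam_pos by (simp add: c1_def c1_inf_def c1_two_def)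
qed

text \<open>On the interval the node polynomial is at most \<open>2 ^ n\<close>, so the bound for the norm of the fooling
  function costs a second factor \<open>2 ^ n\<close>.\<close>

lemma emin_at_lower:
  assumes n: "n \<ge> 1" and X: "\<And>k. k \<in> {1..n} \<Longrightarrow> X k \<in> {-1..1}" and x: "x \<in> {-1..1}"
    and nz: "x \<notin> X ` {1..n}"
  shows "ennreal (c1_inf lam \<phi>min * 2 powr (- 2 * real n) * \<alpha> n powr (-1/2))
    \<le> emin_at \<phi> \<alpha> n X x / ennreal \<bar>poly (node_poly X n) x\<bar>"
proof (rule ennreal_ratio_ge)
  let ?C = "c1_inf lam \<phi>min * 2 powr (- real n) * \<alpha> n powr (-1/2)"
  let ?N = "HK_norm \<phi> \<alpha> (fooling X n)"
  let ?Z = "\<bar>poly (node_poly X n) x\<bar>"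
  have two: "(2::real) powr (- 2 * real n) = 2 powr (- real n) / 2 ^ n"
    by (simp add: powr_diff[symmetric] flip: powr_realpow)
  have C: "?C * ?N \<le> \<phi>min * 2 ^ n"
    by (rule fooling_norm_le_sup_norm[OF n abs_node_poly_le[OF X]])
  show "ennreal (c1_inf lam \<phi>min * 2 powr (- 2 * real n) * \<alpha> n powr (-1/2) * ?Z) \<le> emin_at \<phi> \<alpha> n X x"
  proof (rule emin_at_ge)
    have "c1_inf lam \<phi>min * 2 powr (- 2 * real n) * \<alpha> n powr (-1/2) * ?Z * ?N = ?C * ?N / 2 ^ n * ?Z"
      unfolding two by simp
    also have "\<dots> \<le> \<phi>min * ?Z"
      using C by (intro mult_right_mono) (auto simp: divide_le_eq)
    also have "\<dots> \<le> \<bar>fooling X n x\<bar>"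
      using fooling_abs_ge[OF x, of X n] \<phi>min_pos by (simp add: abs_mult)
    finally show "c1_inf lam \<phi>min * 2 powr (- 2 * real n) * \<alpha> n powr (-1/2) * ?Z * ?N \<le> \<bar>fooling X n x\<bar>" .
  qed (use \<phi>min_pos lam_pos in \<open>simp add: c1_inf_def\<close>)
  show "0 < ?Z" using nz by (simp add: node_poly_eq_0_iff)
  show "0 \<le> c1_inf lam \<phi>min * 2 powr (- 2 * real n) * \<alpha> n powr (-1/2)"
    using \<phi>min_pos lam_pos by (simp add: c1_inf_def)
qed

lemma emin_at_upper:
  assumes n: "m_L lam \<le> real n" and X: "\<And>k. k \<in> {1..n} \<Longrightarrow> X k \<in> {-1..1}"
    and inj: "inj_on X {1..n}" and x: "x \<in> {-1..1}" and nz: "x \<notin> X ` {1..n}"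
  shows "emin_at \<phi> \<alpha> n X x / ennreal \<bar>poly (node_poly X n) x\<bar> \<le> ennreal (error_bound n)"
proof -
  have pos: "0 < \<bar>poly (node_poly X n) x\<bar>" using nz by (simp add: node_poly_eq_0_iff)
  have "emin_at \<phi> \<alpha> n X x / ennreal \<bar>poly (node_poly X n) x\<bar>
      \<le> ennreal (error_bound n * \<bar>poly (node_poly X n) x\<bar>) / ennreal \<bar>poly (node_poly X n) x\<bar>"
    by (rule divide_right_mono_ennreal[OF emin_at_le[OF n X inj x]])
  also have "\<dots> = ennreal (error_bound n)" using pos error_bound_nonneg[of n] by (subst divide_ennreal) auto
  finally show ?thesis .
qed

lemma emin_points_upper:
  assumes n: "m_L lam \<le> real n" and X: "\<And>k. k \<in> {1..n} \<Longrightarrow> X k \<in> {-1..1}"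
    and inj: "inj_on X {1..n}" and p: "p \<in> {2, \<infinity>}"
  shows "emin_points \<phi> \<alpha> p n X
    \<le> ennreal (c2 p lam * \<phi>max * real n powr (-1/8 - enn2real (1 / p))
                 * exp (sqrt (lam * real n)) * 2 powr real n * \<alpha> n powr (-1/2))"
proof -
  have n0: "real n > 0" using n lam_pos by (auto simp: m_L_le_iff)
  then have n1: "n \<ge> 1" by simp
  define E where "E = (if p = \<infinity> then 2 ^ n else 2 ^ n / sqrt (real n))"
  have "emin_points \<phi> \<alpha> p n X \<le> ennreal (error_bound n * E)"
  proof (rule emin_points_le[OF n X inj p])
    assume "p = 2"
    then show "integral {-1..1} (\<lambda>t. (poly (node_poly X n) t)\<^sup>2) \<le> E\<^sup>2"
      using integral_node_poly_square_le[OF X n1] by (simp add: E_def power_divide)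
  qed (use abs_node_poly_le[OF X] in \<open>auto simp: E_def\<close>)
  also have "error_bound n * E \<le> c2 p lam * \<phi>max * real n powr (-1/8 - enn2real (1 / p))
                 * exp (sqrt (lam * real n)) * 2 powr real n * \<alpha> n powr (-1/2)"
  proof (cases "p = \<infinity>")
    case True
    then show ?thesis by (simp add: error_bound_def E_def c2_def powr_realpow)
  next
    case False
    then have p2: "p = 2" using p by simp
    have half: "enn2real (1 / 2) = 1 / 2"
      by (metis enn2real_ennreal divide_ennreal ennreal_1 ennreal_numeral less_numeral_extra(1) zero_le_divide_1_iff zero_le_numeral zero_le_one zero_less_numeral)
    have "real n powr (-1/8 - enn2real (1 / p)) = real n powr (-1/8) / sqrt (real n)"
      unfolding p2 half using n0 by (simp only: powr_diff powr_half_sqrt of_nat_0_le_iff)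
    moreover have "c2_inf lam \<le> c2 p lam"
      using c_L_pos[OF lam_pos] by (simp add: p2 c2_def c2_inf_def c2_two_def)
    then have "c2_inf lam * (\<phi>max * (real n powr (-1/8) / sqrt (real n)) * exp (sqrt (lam * real n)) * 2 ^ n * \<alpha> n powr (-1/2))
       \<le> c2 p lam * (\<phi>max * (real n powr (-1/8) / sqrt (real n)) * exp (sqrt (lam * real n)) * 2 ^ n * \<alpha> n powr (-1/2))"
      using \<phi>max_pos by (intro mult_right_mono) auto
    ultimately show ?thesis by (simp add: error_bound_def E_def p2 powr_realpow mult_ac)
  qed
  finally show ?thesis by (simp add: ennreal_leI order_trans)
qed

lemma emin_upper:
  assumes n: "m_L lam \<le> real n" and p: "p \<in> {2, \<infinity>}"
  shows "emin \<phi> \<alpha> p n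
    \<le> ennreal (2 * c2 p lam * \<phi>max * real n powr (-1/8)
               * exp (sqrt (lam * real n)) * 2 powr (- real n) * \<alpha> n powr (-1/2))"
proof -
  have "real n > 0" using n lam_pos by (auto simp: m_L_le_iff)
  then have n1: "n \<ge> 1" by simp
  define X where "X k = cos (real (2 * k - 1) * pi / real (2 * n))" for k
  note X = chebyshev_nodes[OF n1, folded X_def]
  define E where "E = (if p = \<infinity> then 2 / 2 ^ n else sqrt 2 * (2 / 2 ^ n) :: real)"
  have "emin \<phi> \<alpha> p n \<le> emin_points \<phi> \<alpha> p n X"
    unfolding emin_def using X(2) by (intro INF_lower) auto
  also have "\<dots> \<le> ennreal (error_bound n * E)"
  proof (rule emin_points_le[OF n X(2,1) p])
    assume "p = 2"
    have "integral {-1..1} (\<lambda>t. (poly (node_poly X n) t)\<^sup>2) \<le> integral {-1..1} (\<lambda>t::real. (2 / 2 ^ n)\<^sup>2)"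
    proof (intro integral_le integrable_continuous_real continuous_intros)
      fix t :: real assume "t \<in> {-1..1}"
      from power_mono[OF X(3)[OF this], of 2] show "(poly (node_poly X n) t)\<^sup>2 \<le> (2 / 2 ^ n)\<^sup>2"
        by simp
    qed
    also have "\<dots> = 2 * (2 / 2 ^ n)\<^sup>2" by simp
    also have "\<dots> = E\<^sup>2"
      using \<open>p = 2\<close> by (simp add: E_def power_mult_distrib power_divide)
    finally show "integral {-1..1} (\<lambda>t. (poly (node_poly X n) t)\<^sup>2) \<le> E\<^sup>2" .
  qed (use X(3) in \<open>auto simp: E_def\<close>)
  also have "error_bound n * E = 2 * c2 p lam * \<phi>max * real n powr (-1/8)
               * exp (sqrt (lam * real n)) * 2 powr (- real n) * \<alpha> n powr (-1/2)"
  proof -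
    have "2 powr (- real n) = 1 / 2 ^ n" by (simp add: powr_minus_divide powr_realpow)
    moreover have "c2_inf lam * E = 2 * c2 p lam / 2 ^ n"
      by (simp add: E_def c2_def c2_inf_def c2_two_def real_sqrt_mult)
    moreover have "error_bound n * E = (c2_inf lam * E) * \<phi>max * real n powr (-1/8)
        * exp (sqrt (lam * real n)) * \<alpha> n powr (-1/2)"
      by (simp add: error_bound_def)
    ultimately show ?thesis by simp
  qed
  finally show ?thesis .
qed

end

theorem theorem3p1:
  fixes \<phi> :: "real \<Rightarrow> real" and \<alpha> :: "nat \<Rightarrow> real" and lam \<phi>min \<phi>max :: real
    and p :: ennreal and n :: nat
  assumes "\<phi> \<in> borel_measurable (lebesgue_on {-1..1})"
    and "\<And>x. x \<in> {-1..1} \<Longrightarrow> \<phi> x \<noteq> 0"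
    and "\<And>k. \<alpha> k > 0"
    and "summable (\<lambda>k. inverse (\<alpha> k))"
    and "0 < \<phi>min"
    and "\<And>x. x \<in> {-1..1} \<Longrightarrow> \<phi>min \<le> \<bar>\<phi> x\<bar> \<and> \<bar>\<phi> x\<bar> \<le> \<phi>max"
    and "lam > 0"
    and "\<And>m k. k \<le> m \<Longrightarrow> \<alpha> k / \<alpha> m \<le> lam ^ (m - k) * (fact k / fact m)"
    and "p \<in> {2, \<infinity>}"
  shows
    "(\<forall>X :: nat \<Rightarrow> real. (\<forall>k\<in>{1..n}. X k \<in> {-1..1}) \<and> inj_on X {1..n} \<longrightarrow>
        (n \<ge> 1 \<longrightarrow>
          ennreal (c1 p lam \<phi>min * 2 powr (- real n) * \<alpha> n powr (-1/2))
            \<le> emin_points \<phi> \<alpha> p n X) \<and>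
        (real n \<ge> m_L lam \<longrightarrow>
          emin_points \<phi> \<alpha> p n X
            \<le> ennreal (c2 p lam * \<phi>max * real n powr (-1/8 - enn2real (1 / p))
                 * exp (sqrt (lam * real n)) * 2 powr real n * \<alpha> n powr (-1/2))))
     \<and>
     (n \<ge> 1 \<longrightarrow>
        ennreal (c1 p lam \<phi>min * 2 powr (- real n) * \<alpha> n powr (-1/2)) \<le> emin \<phi> \<alpha> p n) \<and>
     (real n \<ge> m_L lam \<longrightarrow>
        emin \<phi> \<alpha> p n
          \<le> ennreal (2 * c2 p lam * \<phi>max * real n powr (-1/8)
               * exp (sqrt (lam * real n)) * 2 powr (- real n) * \<alpha> n powr (-1/2)))
     \<and>
     (\<forall>X :: nat \<Rightarrow> real. (\<forall>k\<in>{1..n}. X k \<in> {-1..1}) \<and> inj_on X {1..n} \<longrightarrow>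
        (\<forall>x\<in>{-1..1} - X ` {1..n}.
          (n \<ge> 1 \<longrightarrow>
            ennreal (c1_inf lam \<phi>min * 2 powr (- 2 * real n) * \<alpha> n powr (-1/2))
              \<le> emin_at \<phi> \<alpha> n X x / ennreal \<bar>\<Prod>k=1..n. (x - X k)\<bar>) \<and>
          (real n \<ge> m_L lam \<longrightarrow>
            emin_at \<phi> \<alpha> n X x / ennreal \<bar>\<Prod>k=1..n. (x - X k)\<bar>
              \<le> ennreal (c2_inf lam * \<phi>max * real n powr (-1/8)
                   * exp (sqrt (lam * real n)) * \<alpha> n powr (-1/2)))))"
proof -
  interpret growth_kernel \<phi> \<alpha> lam \<phi>min \<phi>max
    using assms(1,3-8) by unfold_locales auto
  have err: "c2_inf lam * \<phi>max * real n powr (-1/8) * exp (sqrt (lam * real n)) * \<alpha> n powr (-1/2) = error_bound n"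
    by (simp add: error_bound_def)
  have "ennreal (c1 p lam \<phi>min * 2 powr (- real n) * \<alpha> n powr (-1/2)) \<le> emin \<phi> \<alpha> p n" if "n \<ge> 1"
    unfolding emin_def by (intro INF_greatest emin_points_lower that assms(9))
  then show ?thesis
    unfolding err poly_node_poly[symmetric]
    using emin_points_lower[OF _ assms(9)] emin_points_upper[OF _ _ _ assms(9)] emin_upper[OF _ assms(9)]
      emin_at_lower emin_at_upper
    by (intro conjI allI ballI impI) auto
qed

end
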